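(* Let $U$, $V$, $x_0$, $R$, $\tilde t$ and $U_R$ be as in the context, where $\rho\in(0,1)$ and $R\rho=2|x_0|$. Suppose that $$R^{n+a+1}\int_{\mathbb B_\rho^+}U_R^2(X,0)\,x_{n+1}^a\,dX\ge\tilde\kappa$$ for some $\tilde\kappa,\rho\in(0,1)$ and $R\ge10$. Then there exists a large universal constant $M=M(n,a,\tilde\kappa)$ such that $$M\int_{\mathbb B_{2\rho}^+}U_R^2(X,t)\,x_{n+1}^a\,dX\ge R^{-(n+a+1)}\quad\text{for all }0\le t\le\frac{c}{R^2},$$ where $c>0$ is sufficiently small (independently of $R$ and $x_0$).
   Context: Notation: $n\ge1$, $s\in[1/2,1)$, $a=1-2s\in(-1,0]$; $X=(x,x_{n+1})\in\mathbb R^{n+1}_+=\mathbb R^n\times(0,\infty)$; $B_r(x_0)\subset\mathbb R^n$ is a Euclidean ball; $\mathbb B_r^+((x_0,0))=\{Z\in\mathbb R^{n+1}:|Z-(x_0,0)|<r,\ z_{n+1}>0\}$; the center is omitted when it is $0$; $\nabla,\operatorname{div}$ are taken in $X$. The weighted normal derivative is $\partial^a_{x_{n+1}}U(x,0,t)=\lim_{x_{n+1}\to0^+}x_{n+1}^a\partial_{x_{n+1}}U(x,x_{n+1},t)$. Standing setting: $T>4$ and $\|V\|_{C^2(\mathbb R^n\times[0,T))}\le1$. $U$ is the weak solution of $$x_{n+1}^a\partial_tU+\operatorname{div}(x_{n+1}^a\nabla U)=0\ \text{in }\mathbb R^{n+1}_+\times[0,T),\quad U(x,0,t)=u(x,t),\quad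 \partial^a_{x_{n+1}}U(x,0,t)=Vu\ \text{in }\mathbb R^n\times[0,T),$$ i.e. $x_{n+1}^{a/2}U,\ x_{n+1}^{a/2}\nabla U\in L^2_{loc}$ up to $\{x_{n+1}=0\}$ and $\int\int x_{n+1}^a(U\varphi_t+\langle\nabla U,\nabla\varphi\rangle)\,dX\,dt+\int\int_{\{x_{n+1}=0\}}Vu\varphi\,dx\,dt=0$ for all $\varphi\in C_0^\infty(\overline{\mathbb R^{n+1}_+}\times(0,T))$. It is the time-reversed extension of a function in the domain of $(\partial_t-\Delta)^s$ on $L^2(\mathbb R^{n+1})$ (Fourier multiplier $(4\pi^2|\xi|^2+2\pi i\sigma)^s$). $U$ is identified with its representative continuous up to $\{x_{n+1}=0\}$, and it is known that $\|U\|_{L^\infty}\le C_0$ for a constant $C_0$ depending on the $\mathrm{Dom}((\partial_t-\Delta)^s)$-norm of that function and on $\|V\|_{C^2}$. $C_0$ is fixed throughout; "universal" constants may also depend on it. Rescaling: $x_0\in\mathbb R^n$, $R=2|x_0|/\rho$, $\tilde t\in[0,1/4)$ (a time with $\int_{\mathbb B_1^+}x_{n+1}^aU^2(X,\tilde t)\,dX\ge\tilde\kappa$), and $$U_R(X,t)=U(RX+(x_0,0),R^2t+\tilde t),\qquad t\in[0,1/R^2).$$ It satisfies $x_{n+1}^a\partial_tU_R+\operatorname{div}(x_{n+1}^a\nabla U_R)=0$ in $\mathbb B_5^+\times[0,1/R^2)$ and $\partial^a_{x_{n+1}}U_R=R^{2s}V_RU_R$ on $B_5\times[0,1/R^2)$,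 with $V_R(x,t)=V(Rx+x_0,R^2t+\tilde t)$. *)

theory Defs
  imports "HOL-Analysis.Analysis"
begin

text \<open>
  Points of \<open>\<real>\<^sup>n\<^sup>+\<^sup>1\<close> are pairs \<open>X = (x, y)\<close> with \<open>x :: real ^ 'n\<close> and \<open>y = x\<^bsub>n+1\<^esub> :: real\<close>;
  space-time points are \<open>(X, t)\<close>, and \<open>(x, t)\<close> on the boundary. The norms of these product types
  are the Euclidean ones.
\<close>

definition half_space :: "((real ^ 'n) \<times> real) set" where
  "half_space = {X. snd X > 0}"

definition closed_half_space :: "((real ^ 'n) \<times> real) set" where
  "closed_half_space = {X. snd X \<ge> 0}"

definition half_ball :: "real ^ 'n \<Rightarrow> real \<Rightarrow> ((real ^ 'n) \<times> real) set" where
  "half_ball x0 r = {Z. dist Z (x0, 0) < r \<and> snd Z > 0}"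


subsection \<open>Smoothness\<close>

primrec C_k :: "nat \<Rightarrow> ('e::euclidean_space \<Rightarrow> real) \<Rightarrow> bool" where
  "C_k 0 f \<longleftrightarrow> continuous_on UNIV f"
| "C_k (Suc k) f \<longleftrightarrow>
     (\<forall>z. f differentiable (at z)) \<and>
     (\<forall>i\<in>Basis. C_k k (\<lambda>z. frechet_derivative f (at z) i))"

definition test_function :: "'e::euclidean_space set \<Rightarrow> ('e \<Rightarrow> real) \<Rightarrow> bool" where
  "test_function S \<phi> \<longleftrightarrow>
     (\<forall>k. C_k k \<phi>) \<and> (\<exists>K. compact K \<and> K \<subseteq> S \<and> (\<forall>z. z \<notin> K \<longrightarrow> \<phi> z = 0))"

text \<open>
  \<open>C2_norm_le S K f\<close> says that \<open>f\<close> is of class \<open>C\<^sup>2\<close> on \<open>S\<close> with \<open>\<parallel>f\<parallel> \<le> K\<close>, where the norm is the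
  largest of the suprema over \<open>S\<close> of \<open>\<bar>f\<bar>\<close> and of its first and second partial derivatives. The
  conventions that add up these suprema give a larger norm. Derivatives are taken within \<open>S\<close>, so
  they are one-sided at boundary points belonging to \<open>S\<close>.
\<close>

definition C2_norm_le :: "'e::euclidean_space set \<Rightarrow> real \<Rightarrow> ('e \<Rightarrow> real) \<Rightarrow> bool" where
  "C2_norm_le S K f \<longleftrightarrow>
     (\<exists>(g :: 'e \<Rightarrow> 'e) (h :: 'e \<Rightarrow> 'e \<Rightarrow> 'e).
        (\<forall>z\<in>S. (f has_derivative (\<lambda>v. g z \<bullet> v)) (at z within S)) \<and>
        (\<forall>i\<in>Basis. \<forall>z\<in>S. ((\<lambda>w. g w \<bullet> i) has_derivative (\<lambda>v. h i z \<bullet> v)) (at z within S)) \<and>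
        (\<forall>i\<in>Basis. continuous_on S (h i)) \<and>
        (\<forall>z\<in>S. \<bar>f z\<bar> \<le> K) \<and>
        (\<forall>z\<in>S. \<forall>i\<in>Basis. \<bar>g z \<bullet> i\<bar> \<le> K) \<and>
        (\<forall>z\<in>S. \<forall>i\<in>Basis. \<forall>j\<in>Basis. \<bar>h i z \<bullet> j\<bar> \<le> K))"


subsection \<open>The domain of \<open>(\<partial>\<^sub>t - \<Delta>)\<^sup>s\<close> and the parabolic extension\<close>

definition square_integrable :: "('e::euclidean_space \<Rightarrow> 'b::euclidean_space) \<Rightarrow> bool" where
  "square_integrable f \<longleftrightarrow>
     f \<in> borel_measurable lborel \<and> integrable lborel (\<lambda>z. (norm (f z))\<^sup>2)"

definition fourier_integral :: "('e::euclidean_space \<Rightarrow> real) \<Rightarrow> 'e \<Rightarrow> complex" where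
  "fourier_integral f \<zeta> = (LINT z|lborel. of_real (f z) * cis (- 2 * pi * (z \<bullet> \<zeta>)))"

text \<open>
  The Fourier--Plancherel transform of \<open>f \<in> L\<^sup>2\<close> is the \<open>L\<^sup>2\<close>-limit of the Fourier integrals of the
  truncations of \<open>f\<close> to balls, which are in \<open>L\<^sup>1 \<inter> L\<^sup>2\<close>. It is determined up to null sets, so it is
  rendered as a relation.
\<close>

definition is_fourier_transform :: "('e::euclidean_space \<Rightarrow> real) \<Rightarrow> ('e \<Rightarrow> complex) \<Rightarrow> bool" where
  "is_fourier_transform f g \<longleftrightarrow>
     square_integrable f \<and> square_integrable g \<and>
     ((\<lambda>k::nat. \<integral>\<^sup>+ \<zeta>. ennreal ((norm
          (fourier_integral (\<lambda>z. indicator (ball 0 (real k)) z * f z) \<zeta> - g \<zeta>))\<^sup>2) \<partial>lborel)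
        \<longlonglongrightarrow> 0)"

definition heat_symbol :: "(real ^ 'n) \<times> real \<Rightarrow> complex" where
  "heat_symbol \<zeta> = Complex (4 * pi\<^sup>2 * (norm (fst \<zeta>))\<^sup>2) (2 * pi * snd \<zeta>)"

text \<open>The real part of the symbol is nonnegative, so the principal branch of \<open>powr\<close> is the usual one.\<close>

definition in_heat_domain :: "real \<Rightarrow> ((real ^ 'n) \<times> real \<Rightarrow> real) \<Rightarrow> bool" where
  "in_heat_domain s f \<longleftrightarrow>
     (\<exists>g. is_fourier_transform f g \<and>
          square_integrable (\<lambda>\<zeta>. heat_symbol \<zeta> powr (of_real s) * g \<zeta>))"

text \<open>
  The Poisson formula for the solution \<open>F\<close> of \<open>y powr a * \<partial>\<^sub>t F = div (y powr a * \<nabla>F)\<close>, \<open>a = 1 - 2s\<close>, in the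
  half-space with boundary values \<open>f\<close>: with \<open>H = \<partial>\<^sub>t - \<Delta>\<close>, \<open>F(\<cdot>, y, \<cdot>)\<close> is the integral over \<open>\<tau> > 0\<close> of
  \<open>y powr (2s) / (4 powr s * \<Gamma>(s)) * exp (- y\<^sup>2 / (4\<tau>)) * \<tau> powr (-1-s)\<close> times \<open>exp (-\<tau>H) f\<close>, and
  \<open>(exp (-\<tau>H) f)(\<cdot>, t)\<close> is \<open>f(\<cdot>, t - \<tau>)\<close> convolved with the heat kernel at time \<open>\<tau>\<close>.
\<close>

definition poisson_kernel :: "real \<Rightarrow> real \<Rightarrow> (real ^ 'n) \<times> real \<Rightarrow> real" where
  "poisson_kernel s y w = (case w of (z, \<tau>) \<Rightarrow>
     y powr (2 * s) / (4 powr s * Gamma s) * \<tau> powr (- 1 - s)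
       * (4 * pi * \<tau>) powr (- real CARD('n) / 2) * exp (- ((norm z)\<^sup>2 + y\<^sup>2) / (4 * \<tau>)))"

definition parabolic_extension ::
    "real \<Rightarrow> ((real ^ 'n) \<times> real \<Rightarrow> real) \<Rightarrow> (real ^ 'n) \<times> real \<Rightarrow> real \<Rightarrow> real" where
  "parabolic_extension s f X t =
     (LINT w:UNIV \<times> {0<..}|lborel. poisson_kernel s (snd X) w * f ((fst X, t) - w))"

definition time_reversed_extension ::
    "real \<Rightarrow> real \<Rightarrow> ((real ^ 'n) \<times> real \<Rightarrow> real)
      \<Rightarrow> (((real ^ 'n) \<times> real) \<times> real \<Rightarrow> real) \<Rightarrow> bool" where
  "time_reversed_extension s T f U \<longleftrightarrow>
     (\<forall>X\<in>half_space. \<forall>t\<in>{0..<T}. U (X, t) = parabolic_extension s f X (- t)) \<and>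
     (AE (x, t) in lborel. 0 \<le> t \<and> t < T \<longrightarrow> U ((x, 0), t) = f (x, - t))"


subsection \<open>Weak solutions of the extension problem\<close>

text \<open>\<open>y\<^sup>a\<^sup>/\<^sup>2 F \<in> L\<^sup>2\<^sub>l\<^sub>o\<^sub>c\<close> in the half-space times \<open>(0, T)\<close>, up to \<open>{y = 0}\<close>.\<close>

definition weighted_L2_loc ::
    "real \<Rightarrow> real \<Rightarrow> (((real ^ 'n) \<times> real) \<times> real \<Rightarrow> 'b::euclidean_space) \<Rightarrow> bool" where
  "weighted_L2_loc a T F \<longleftrightarrow>
     set_borel_measurable lborel (half_space \<times> {0<..<T}) F \<and>
     (\<forall>K. compact K \<and> K \<subseteq> closed_half_space \<times> {0<..<T} \<longrightarrow>
        set_integrable lborel (K \<inter> (half_space \<times> UNIV))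
          (\<lambda>(X, t). (norm ((snd X) powr (a / 2) *\<^sub>R F (X, t)))\<^sup>2))"

text \<open>
  The weak gradient in the space variable \<open>X\<close>. For a test function \<open>\<psi>\<close> in space-time, the value
  \<open>\<langle>\<nabla>\<psi>, v\<rangle>\<close> is the derivative of \<open>\<psi>\<close> in the direction \<open>(v, 0)\<close>, and \<open>\<psi>\<^sub>t\<close> that in the direction \<open>(0, 1)\<close>.
\<close>

definition weak_gradient ::
    "real \<Rightarrow> (((real ^ 'n) \<times> real) \<times> real \<Rightarrow> real)
      \<Rightarrow> (((real ^ 'n) \<times> real) \<times> real \<Rightarrow> (real ^ 'n) \<times> real) \<Rightarrow> bool" where
  "weak_gradient T U G \<longleftrightarrow>
     (\<forall>\<psi> v. test_function (half_space \<times> {0<..<T}) \<psi> \<longrightarrow>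
        (LINT z:half_space \<times> {0<..<T}|lborel. U z * frechet_derivative \<psi> (at z) (v, 0))
          = - (LINT z:half_space \<times> {0<..<T}|lborel. (G z \<bullet> v) * \<psi> z))"

text \<open>
  Test functions that need not vanish on \<open>{y = 0}\<close> are restrictions of test functions on
  \<open>\<real>\<^sup>n\<^sup>+\<^sup>1 \<times> (0, T)\<close>. The boundary value \<open>u\<close> is \<open>U\<close> at \<open>y = 0\<close>.
\<close>

definition weak_solution ::
    "real \<Rightarrow> real \<Rightarrow> ((real ^ 'n) \<times> real \<Rightarrow> real)
      \<Rightarrow> (((real ^ 'n) \<times> real) \<times> real \<Rightarrow> real) \<Rightarrow> bool" where
  "weak_solution a T V U \<longleftrightarrow>
     (\<exists>G. weak_gradient T U G \<and> weighted_L2_loc a T U \<and> weighted_L2_loc a T G \<and>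
        (\<forall>\<phi>. test_function (UNIV \<times> {0<..<T}) \<phi> \<longrightarrow>
           (LINT z:half_space \<times> {0<..<T}|lborel. (snd (fst z)) powr a *
               (U z * frechet_derivative \<phi> (at z) (0, 1) + frechet_derivative \<phi> (at z) (G z, 0)))
           + (LINT (x, t):UNIV \<times> {0<..<T}|lborel. V (x, t) * U ((x, 0), t) * \<phi> ((x, 0), t)) = 0))"

definition standing_setting ::
    "real \<Rightarrow> real \<Rightarrow> real \<Rightarrow> ((real ^ 'n) \<times> real \<Rightarrow> real)
      \<Rightarrow> (((real ^ 'n) \<times> real) \<times> real \<Rightarrow> real) \<Rightarrow> bool" where
  "standing_setting s C0 T V U \<longleftrightarrow>
     T > 4 \<and>
     C2_norm_le (UNIV \<times> {0..<T}) 1 V \<and>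
     weak_solution (1 - 2 * s) T V U \<and>
     (\<exists>f. in_heat_domain s f \<and> time_reversed_extension s T f U) \<and>
     continuous_on (closed_half_space \<times> {0..<T}) U \<and>
     (\<forall>z\<in>closed_half_space \<times> {0..<T}. \<bar>U z\<bar> \<le> C0)"

definition rescaled ::
    "(((real ^ 'n) \<times> real) \<times> real \<Rightarrow> real) \<Rightarrow> real ^ 'n \<Rightarrow> real \<Rightarrow> real
      \<Rightarrow> ((real ^ 'n) \<times> real) \<times> real \<Rightarrow> real" where
  "rescaled U x0 R t0 = (\<lambda>(X, t). U (R *\<^sub>R X + (x0, 0), R\<^sup>2 * t + t0))"

end

theory Submission imports Defs begin

text \<open>
  Undoing the rescaling turns the claim into one about \<open>U\<close> itself. With \<open>r = R \<rho> = 2 \<bar>x0\<bar>\<close>: if the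
  weighted mass \<open>\<integral> y\<^sup>a U\<^sup>2\<close> over the half-ball of radius \<open>r\<close> about \<open>x0\<close> is at least \<open>\<kappa>\<close> at time \<open>t0\<close>,
  then the mass over the half-ball of radius \<open>2 r\<close> stays above a positive constant for a short
  time, both the constant and the time depending only on \<open>n\<close>, \<open>a\<close>, \<open>\<kappa>\<close> and \<open>C0\<close>.

  Since \<open>\<bar>U\<bar> \<le> C0\<close> and \<open>y\<^sup>a\<close> is integrable at \<open>0\<close>, the slab \<open>y < h\<close> carries mass at most \<open>\<kappa>/2\<close>
  once \<open>h\<close> is small (\<open>weighted_square_integrable\<close>). Hence mass at least \<open>\<kappa>/2\<close> lies at height at least
  \<open>h\<close>; in particular \<open>r \<ge> h\<close>, so small radii do not occur, and the cutoffs can be supported in the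
  open half-space, where the equation is uniformly parabolic.

  There \<open>W = y\<^bsup>a/2\<^esup> U\<close> satisfies \<open>W\<^sub>t + \<Delta>W = k W / y\<^sup>2\<close> with \<open>k = (a/2)(a/2 - 1)\<close>, in the sense of
  distributions (\<open>weak_solution_distributional\<close>), and \<open>W\<^sup>2 = y\<^sup>a U\<^sup>2\<close> is exactly the density of the mass.
  The left-hand side has constant coefficients, so a mollification \<open>w\<close> of \<open>W\<close> is a smooth solution
  of \<open>w\<^sub>t + \<Delta>w = g\<close> with \<open>w\<close> and \<open>g\<close> bounded in terms of \<open>C0\<close> and the distance to \<open>{y = 0}\<close>. For a cutoff
  \<open>\<phi>\<close>, integration by parts and completing a square give
  \<open>d/dt \<integral> w\<^sup>2 \<phi>\<^sup>2 = 2 \<integral> \<bar>\<nabla>w\<bar>\<^sup>2 \<phi>\<^sup>2 + 4 \<integral> w \<phi> \<nabla>w \<bullet> \<nabla>\<phi> + 2 \<integral> w g \<phi>\<^sup>2 \<ge> - 2 \<integral> w\<^sup>2 \<bar>\<nabla>\<phi>\<bar>\<^sup>2 - 2 \<integral> \<bar>w g\<bar> \<phi>\<^sup>2\<close>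
  (\<open>energy_inequality\<close>): the equation runs backward in time, so the gradient term has the good
  sign and the localized mass decreases at a bounded rate. The rate does not depend on the
  mollification parameter, which is then sent to \<open>0\<close> (\<open>interior_energy_inequality\<close>).

  The rate is uniform for \<open>r \<le> 2\<close> (\<open>local_mass_persistence\<close>), which covers \<open>\<bar>x0\<bar> \<le> 1\<close>. If \<open>\<bar>x0\<bar> > 1\<close>,
  the half-ball of radius \<open>2 r = 4 \<bar>x0\<bar>\<close> about \<open>x0\<close> contains the one of radius \<open>2\<close> about \<open>0\<close>, and
  the lower bound on the mass over the unit half-ball persists there.
\<close>

section \<open>Smooth functions and a bump function\<close>

lemma C_k_SucI:
  assumes "\<And>z. (f has_derivative f' z) (at z)"
    and "\<And>i. i \<in> Basis \<Longrightarrow> C_k k (\<lambda>z. f' z i)"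
  shows "C_k (Suc k) f"
proof -
  have "frechet_derivative f (at z) = f' z" for z
    using frechet_derivative_at[OF assms(1)] by metis
  then show ?thesis using assms by (auto simp: differentiable_def)
qed

lemma C_k_has_derivative:
  assumes "C_k (Suc k) f"
  shows "(f has_derivative frechet_derivative f (at z)) (at z)"
  using assms by (auto simp: frechet_derivative_works)

lemma C_k_SucD: "C_k (Suc k) f \<Longrightarrow> C_k k f"
proof (induction k arbitrary: f)
  case 0
  then show ?case
    by (auto intro!: continuous_at_imp_continuous_on differentiable_imp_continuous_within)
next
  case (Suc k)
  then show ?case by (metis C_k.simps(2))
qed

lemma C_k_const: "C_k k (\<lambda>z. c)"
proof (induction k arbitrary: c)
  case (Suc k)
  show ?case by (rule C_k_SucI[where f' = "\<lambda>z v. 0"]) (use Suc in auto)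
qed auto

lemma C_k_inner: "C_k k (\<lambda>z. z \<bullet> b)"
proof (cases k)
  case (Suc m)
  show ?thesis unfolding Suc
    by (rule C_k_SucI[where f' = "\<lambda>z v. v \<bullet> b"]) (auto intro!: derivative_eq_intros C_k_const)
qed (auto intro!: continuous_intros)

lemma C_k_add: "C_k k f \<Longrightarrow> C_k k g \<Longrightarrow> C_k k (\<lambda>z. f z + g z)"
proof (induction k arbitrary: f g)
  case 0
  then show ?case by (auto intro!: continuous_intros)
next
  case (Suc k)
  show ?case
    by (rule C_k_SucI, rule has_derivative_add)
       (use Suc in \<open>auto intro: C_k_has_derivative\<close>)
qed

lemma C_k_mult: "C_k k f \<Longrightarrow> C_k k g \<Longrightarrow> C_k k (\<lambda>z. f z * g z)"
proof (induction k arbitrary: f g)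
  case 0
  then show ?case by (auto intro!: continuous_intros)
next
  case (Suc k)
  show ?case
  proof (rule C_k_SucI)
    fix z
    show "((\<lambda>z. f z * g z) has_derivative
      (\<lambda>v. f z * frechet_derivative g (at z) v + frechet_derivative f (at z) v * g z)) (at z)"
      by (rule has_derivative_mult) (use Suc.prems in \<open>auto intro: C_k_has_derivative\<close>)
  next
    fix i :: 'a assume "i \<in> Basis"
    then show "C_k k (\<lambda>z. f z * frechet_derivative g (at z) i + frechet_derivative f (at z) i * g z)"
      using Suc C_k_SucD by (intro C_k_add Suc.IH) auto
  qed
qed

lemma C_k_cmult: "C_k k f \<Longrightarrow> C_k k (\<lambda>z. c * f z)"
  by (intro C_k_mult C_k_const)

lemma C_k_diff: "C_k k f \<Longrightarrow> C_k k g \<Longrightarrow> C_k k (\<lambda>z. f z - g z)"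
  using C_k_add[of k f "\<lambda>z. (-1) * g z"] C_k_cmult[of k g "-1"] by simp

lemma C_k_sum: "finite A \<Longrightarrow> (\<And>i. i \<in> A \<Longrightarrow> C_k k (f i)) \<Longrightarrow> C_k k (\<lambda>z. \<Sum>i\<in>A. f i z)"
  by (induction A rule: finite_induct) (auto intro: C_k_add C_k_const)

lemma C_k_continuous: "C_k k f \<Longrightarrow> continuous_on UNIV f"
  by (induction k) (simp, use C_k_SucD in blast)

lemma C_k_shift: "C_k k f \<Longrightarrow> C_k k (\<lambda>z. f (z - c))"
proof (induction k arbitrary: f)
  case 0
  then have "continuous_on UNIV f" by simp
  then have "continuous_on UNIV (\<lambda>z. f (z - c))"
    by (rule continuous_on_compose2) (auto intro!: continuous_intros)
  then show ?case by simp
next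
  case (Suc k)
  show ?case
  proof (rule C_k_SucI)
    fix z
    have "(f has_derivative frechet_derivative f (at (z - c))) (at (z - c))"
      using Suc.prems by (rule C_k_has_derivative)
    have "((\<lambda>z. z - c) has_derivative (\<lambda>v. v)) (at z)"
      by (auto intro!: derivative_eq_intros)
    from has_derivative_compose[OF this \<open>(f has_derivative _) _\<close>]
    show "((\<lambda>z. f (z - c)) has_derivative (\<lambda>v. frechet_derivative f (at (z - c)) v)) (at z)" .
  qed (use Suc in auto)
qed

text \<open>
  The functions \<open>exp (-1/x) / x\<^sup>m\<close>, extended by \<open>0\<close>. The index \<open>m\<close> is there because the derivative
  of a member is a linear combination of members, which makes smoothness an induction.
\<close>

definition exp_cutoff :: "nat \<Rightarrow> real \<Rightarrow> real" where
  "exp_cutoff m x = (if x > 0 then exp (- (1 / x)) / x ^ m else 0)"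

lemma exp_cutoff_tendsto_0: "(exp_cutoff m \<longlongrightarrow> 0) (at 0)"
proof -
  have "((\<lambda>x::real. x ^ m / exp x) \<longlongrightarrow> 0) at_top"
    by (rule tendsto_power_div_exp_0)
  then have "((\<lambda>x. inverse x ^ m / exp (inverse x)) \<longlongrightarrow> 0) (at_right (0::real))"
    by (rule filterlim_compose[OF _ filterlim_inverse_at_top_right])
  then have "(exp_cutoff m \<longlongrightarrow> 0) (at_right 0)"
    by (rule Lim_transform_eventually)
       (auto simp: exp_cutoff_def eventually_at_filter exp_minus field_simps)
  moreover have "(exp_cutoff m \<longlongrightarrow> 0) (at_left 0)"
    by (rule tendsto_eventually) (auto simp: exp_cutoff_def eventually_at_filter)
  ultimately show ?thesis by (simp add: filterlim_at_split)
qed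

lemma exp_cutoff_has_derivative:
  "(exp_cutoff m has_real_derivative
     exp_cutoff (m + 2) x - real m * exp_cutoff (m + 1) x) (at x)"
proof (cases x "0::real" rule: linorder_cases)
  case less
  have "((\<lambda>x. 0) has_real_derivative 0) (at x)" by simp
  then have "(exp_cutoff m has_real_derivative 0) (at x)"
    by (rule has_field_derivative_transform_within_open[where S = "{..<0}"])
       (use less in \<open>auto simp: exp_cutoff_def\<close>)
  then show ?thesis using less by (simp add: exp_cutoff_def)
next
  case equal
  have "(\<lambda>y. (exp_cutoff m y - exp_cutoff m 0) / (y - 0)) = exp_cutoff (m + 1)"
    by (auto simp: exp_cutoff_def fun_eq_iff)
  then show ?thesis
    using exp_cutoff_tendsto_0[of "m + 1"] equal
    by (simp add: has_field_derivative_iff exp_cutoff_def)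
next
  case greater
  have "((\<lambda>x. exp (- (1 / x)) * inverse x ^ m) has_real_derivative
     exp (- (1 / x)) * (1 / x\<^sup>2) * inverse x ^ m
       + exp (- (1 / x)) * (real m * inverse x ^ (m - 1) * (- (inverse x)\<^sup>2))) (at x)"
    using greater by (auto intro!: derivative_eq_intros simp: power2_eq_square divide_inverse)
  then have "(exp_cutoff m has_real_derivative 
     exp (- (1 / x)) * (1 / x\<^sup>2) * inverse x ^ m
       + exp (- (1 / x)) * (real m * inverse x ^ (m - 1) * (- (inverse x)\<^sup>2))) (at x)"
    by (rule has_field_derivative_transform_within_open[where S = "{0<..}"])
       (use greater in \<open>auto simp: exp_cutoff_def power_inverse field_simps\<close>)
  also have "exp (- (1 / x)) * (1 / x\<^sup>2) * inverse x ^ m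
       + exp (- (1 / x)) * (real m * inverse x ^ (m - 1) * (- (inverse x)\<^sup>2))
     = exp_cutoff (m + 2) x - real m * exp_cutoff (m + 1) x"
    using greater by (cases m) (auto simp: exp_cutoff_def power2_eq_square field_simps)
  finally show ?thesis .
qed

lemma C_k_exp_cutoff:
  assumes "\<And>k. C_k k q"
  shows "C_k k (\<lambda>z. exp_cutoff m (q z))"
proof (induction k arbitrary: m)
  case 0
  have "continuous_on UNIV (exp_cutoff m)"
    by (rule DERIV_continuous_on) (rule exp_cutoff_has_derivative)
  then have "continuous_on UNIV (\<lambda>z. exp_cutoff m (q z))"
    by (rule continuous_on_compose2) (use assms[of 0] in auto)
  then show ?case by simp
next
  case (Suc k)
  show ?case
  proof (rule C_k_SucI)
    fix z
    show "((\<lambda>z. exp_cutoff m (q z)) has_derivative (\<lambda>v.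
       (exp_cutoff (m + 2) (q z) - real m * exp_cutoff (m + 1) (q z))
         * frechet_derivative q (at z) v)) (at z)"
      by (rule has_derivative_compose[OF C_k_has_derivative[OF assms]
          exp_cutoff_has_derivative[unfolded has_field_derivative_def]])
  next
    fix i :: 'a assume "i \<in> Basis"
    then show "C_k k (\<lambda>z. (exp_cutoff (m + 2) (q z) - real m * exp_cutoff (m + 1) (q z))
         * frechet_derivative q (at z) i)"
      using assms[of "Suc k"] by (intro C_k_mult C_k_diff C_k_cmult Suc.IH) auto
  qed
qed

text \<open>
  The radial bump of radius \<open>e\<close>. The square of the norm is a polynomial in the coordinates, so
  composition with \<open>exp_cutoff\<close> is smooth also at \<open>0\<close>.
\<close>

definition bump :: "real \<Rightarrow> 'e::euclidean_space \<Rightarrow> real" where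
  "bump e z = exp_cutoff 0 (e\<^sup>2 - (norm z)\<^sup>2)"

lemma C_k_bump: "C_k k (bump e :: 'e::euclidean_space \<Rightarrow> real)"
proof -
  have *: "e\<^sup>2 - (norm z)\<^sup>2 = e\<^sup>2 - (\<Sum>b\<in>Basis. (z \<bullet> b) * (z \<bullet> b))" for z :: 'e
    by (simp add: power2_norm_eq_inner euclidean_inner[of z z])
  show ?thesis
    unfolding bump_def[abs_def] *
    by (intro C_k_exp_cutoff C_k_diff C_k_const C_k_sum C_k_mult C_k_inner) auto
qed

lemma bump_nonneg: "bump e z \<ge> 0"
  by (auto simp: bump_def exp_cutoff_def)

lemma bump_pos_iff: "e > 0 \<Longrightarrow> bump e z > 0 \<longleftrightarrow> norm z < e"
  using power_strict_mono[of "norm z" e 2] power2_less_imp_less[of "norm z" e]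
  by (auto simp: bump_def exp_cutoff_def)

lemma bump_eq_0: "e > 0 \<Longrightarrow> norm z \<ge> e \<Longrightarrow> bump e z = 0"
  using bump_pos_iff[of e z] bump_nonneg[of e z] by linarith

section \<open>The interior equation for the weighted solution\<close>

lemma frechet_derivative_zero_off_support:
  assumes "closed K" and "\<And>z. z \<notin> K \<Longrightarrow> f z = 0" and "z \<notin> K"
  shows "(f has_derivative (\<lambda>v. 0)) (at z)"
proof -
  have "((\<lambda>z. 0) has_derivative (\<lambda>v. 0)) (at z)" by simp
  then show ?thesis
    by (rule has_derivative_transform_within_open[where s = "- K"]) (use assms in auto)
qed

lemma test_function_derivative:
  assumes "test_function S \<phi>" and "i \<in> Basis"
  shows "test_function S (\<lambda>z. frechet_derivative \<phi> (at z) i)"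
proof -
  obtain K where K: "compact K" "K \<subseteq> S" "\<And>z. z \<notin> K \<Longrightarrow> \<phi> z = 0"
    and smooth: "\<And>k. C_k k \<phi>" using assms unfolding test_function_def by blast
  have "frechet_derivative \<phi> (at z) i = 0" if "z \<notin> K" for z
    using fun_cong[OF frechet_derivative_at[OF frechet_derivative_zero_off_support
          [OF compact_imp_closed[OF K(1)] K(3) that]], where x = i] by simp
  then show ?thesis
    using K smooth[of "Suc _"] assms(2) unfolding test_function_def by auto
qed

lemma test_function_mono: "test_function S f \<Longrightarrow> S \<subseteq> S' \<Longrightarrow> test_function S' f"
  unfolding test_function_def by (meson subset_trans)

lemma test_function_has_derivative:
  assumes "test_function S f"
  shows "(f has_derivative frechet_derivative f (at z)) (at z)"
  using assms C_k_has_derivative[of 0] unfolding test_function_def by blast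

lemma test_function_continuous: "test_function S f \<Longrightarrow> continuous_on A f"
  unfolding test_function_def using C_k_continuous continuous_on_subset by blast

abbreviation height :: "((real ^ 'n) \<times> real) \<times> real \<Rightarrow> real" where
  "height z \<equiv> snd (fst z)"

lemma open_half_space: "open half_space"
  unfolding half_space_def by (intro open_Collect_less continuous_intros)

text \<open>
  Powers of the height are not smooth on the whole space, but a test function supported in the
  open half-space vanishes near the singular set, so the product rule holds everywhere. The result
  has again the form of powers of the height times test functions.
\<close>

lemma height_powr_mult_has_derivative:
  fixes \<theta> :: "((real ^ 'n) \<times> real) \<times> real \<Rightarrow> real"
  assumes \<theta>: "test_function (half_space \<times> I) \<theta>"
  shows "((\<lambda>z. height z powr p * \<theta> z) has_derivative
     (\<lambda>v. p * snd (fst v) * (height z powr (p - 1) * \<theta> z)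
           + height z powr p * frechet_derivative \<theta> (at z) v)) (at z)"
proof -
  obtain K where K: "compact K" "K \<subseteq> half_space \<times> I" "\<And>z. z \<notin> K \<Longrightarrow> \<theta> z = 0"
    using \<theta> unfolding test_function_def by blast
  note D = test_function_has_derivative[OF \<theta>, of z]
  show ?thesis
  proof (cases "height z > 0")
    case True
    have h: "(height has_derivative (\<lambda>v. snd (fst v))) (at z)"
      by (auto intro!: derivative_eq_intros)
    have "((\<lambda>z. height z powr p) has_derivative
        (\<lambda>v. p * height z powr (p - 1) * snd (fst v))) (at z)"
      using has_derivative_compose[OF h has_real_derivative_powr[OF True, unfolded has_field_derivative_def]]
      by simp
    from has_derivative_mult[OF this D] show ?thesis
      by (rule has_derivative_eq_rhs) (auto simp: algebra_simps)
  next
    case False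
    then have "z \<notin> K" using K(2) by (auto simp: half_space_def)
    note zero = frechet_derivative_zero_off_support[OF compact_imp_closed[OF K(1)] _ this]
    have "frechet_derivative \<theta> (at z) = (\<lambda>v. 0)"
      using frechet_derivative_at[OF zero[OF K(3)]] by simp
    then show ?thesis
      using zero[of "\<lambda>z. height z powr p * \<theta> z"] K(3) \<open>z \<notin> K\<close> by simp
  qed
qed

lemma test_function_height_powr_mult:
  fixes \<theta> :: "((real ^ 'n) \<times> real) \<times> real \<Rightarrow> real"
  assumes "test_function (half_space \<times> I) \<theta>"
  shows "test_function (half_space \<times> I) (\<lambda>z. height z powr p * \<theta> z)"
proof -
  have "C_k k (\<lambda>z. height z powr p * \<theta> z)" for k
    using assms
  proof (induction k arbitrary: p \<theta>)
    case 0
    then show ?case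
      by (auto intro!: continuous_at_imp_continuous_on has_derivative_continuous
          height_powr_mult_has_derivative)
  next
    case (Suc k)
    show ?case
    proof (rule C_k_SucI[OF height_powr_mult_has_derivative[OF Suc.prems]])
      fix i :: "((real ^ 'n) \<times> real) \<times> real" assume "i \<in> Basis"
      then show "C_k k (\<lambda>z. p * snd (fst i) * (height z powr (p - 1) * \<theta> z)
           + height z powr p * frechet_derivative \<theta> (at z) i)"
        by (intro C_k_add C_k_cmult Suc.IH Suc.prems test_function_derivative)
    qed
  qed
  moreover obtain K where "compact K" "K \<subseteq> half_space \<times> I" "\<forall>z. z \<notin> K \<longrightarrow> \<theta> z = 0"
    using assms unfolding test_function_def by blast
  ultimately show ?thesis unfolding test_function_def by (auto intro!: exI[of _ K])
qed

lemma frechet_derivative_height_powr_mult: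
  fixes \<theta> :: "((real ^ 'n) \<times> real) \<times> real \<Rightarrow> real"
  assumes "test_function (half_space \<times> I) \<theta>"
  shows "frechet_derivative (\<lambda>z. height z powr p * \<theta> z) (at z) v
     = p * snd (fst v) * (height z powr (p - 1) * \<theta> z)
        + height z powr p * frechet_derivative \<theta> (at z) v"
proof -
  have "frechet_derivative (\<lambda>z. height z powr p * \<theta> z) (at z)
    = (\<lambda>v. p * snd (fst v) * (height z powr (p - 1) * \<theta> z)
        + height z powr p * frechet_derivative \<theta> (at z) v)"
    by (rule frechet_derivative_at[symmetric]) (rule height_powr_mult_has_derivative[OF assms])
  then show ?thesis by (rule fun_cong)
qed

lemma set_integrable_mult_test_function:
  assumes f: "continuous_on S f" and \<psi>: "test_function S \<psi>"
  shows "set_integrable lborel S (\<lambda>z. f z * \<psi> z)"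
proof -
  obtain K where K: "compact K" "K \<subseteq> S" "\<And>z. z \<notin> K \<Longrightarrow> \<psi> z = 0"
    using \<psi> unfolding test_function_def by blast
  have "set_integrable lborel K (\<lambda>z. f z * \<psi> z)"
    unfolding set_integrable_def
    by (rule borel_integrable_compact[OF K(1)])
       (intro continuous_intros continuous_on_subset[OF f K(2)] test_function_continuous[OF \<psi>])
  moreover have "indicator K z *\<^sub>R (f z * \<psi> z) = indicator S z *\<^sub>R (f z * \<psi> z)" for z
    using K(2,3) by (cases "z \<in> K") (auto simp: indicator_def)
  ultimately show ?thesis unfolding set_integrable_def by (simp only:)
qed

text \<open>
  On the support of \<open>\<psi>\<close> the weight \<open>y\<^bsup>a/2\<^esup>\<close> is bounded away from \<open>0\<close>, so \<open>\<bar>G \<bullet> v\<bar> \<bar>\<psi>\<bar>\<close> is at most a constant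
  times \<open>1 + \<bar>y\<^bsup>a/2\<^esup> G\<bar>\<^sup>2\<close>.
\<close>

lemma weighted_L2_loc_mult_test_function:
  fixes G :: "((real ^ 'n) \<times> real) \<times> real \<Rightarrow> (real ^ 'n) \<times> real"
  assumes G: "weighted_L2_loc a T G" and \<psi>: "test_function (half_space \<times> {0<..<T}) \<psi>"
  shows "set_integrable lborel (half_space \<times> {0<..<T}) (\<lambda>z. (G z \<bullet> v) * \<psi> z)"
proof -
  let ?H = "half_space \<times> {0<..<T} :: (((real ^ 'n) \<times> real) \<times> real) set"
  let ?\<chi> = "\<lambda>z. height z powr (- a / 2) * \<psi> z"
  obtain K where K: "compact K" "K \<subseteq> ?H" "\<And>z. z \<notin> K \<Longrightarrow> \<psi> z = 0"
    using \<psi> unfolding test_function_def by blast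
  have "compact (?\<chi> ` K)"
    by (intro compact_continuous_image K(1)
        test_function_continuous[OF test_function_height_powr_mult[OF \<psi>]])
  then obtain B where B: "\<And>z. z \<in> K \<Longrightarrow> \<bar>?\<chi> z\<bar> \<le> B"
    by (force dest: compact_imp_bounded simp: bounded_iff)
  let ?g = "\<lambda>z. (norm (height z powr (a / 2) *\<^sub>R G z))\<^sup>2"
  have meas: "set_borel_measurable lborel ?H G"
    using G unfolding weighted_L2_loc_def by blast
  have L2: "set_integrable lborel (L \<inter> (half_space \<times> UNIV))
      (\<lambda>(X, t). (norm ((snd X) powr (a / 2) *\<^sub>R G (X, t)))\<^sup>2)"
    if "compact L" "L \<subseteq> closed_half_space \<times> {0<..<T}" for L
    using G that unfolding weighted_L2_loc_def by blast
  have KH: "K \<inter> (half_space \<times> UNIV) = K" using K(2) by auto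
  have "K \<subseteq> closed_half_space \<times> {0<..<T}"
    using K(2) by (auto simp: half_space_def closed_half_space_def)
  from L2[OF K(1) this, unfolded KH] have g: "set_integrable lborel K ?g" by (simp add: case_prod_unfold)
  have "set_integrable lborel K (\<lambda>z. 1 :: real)"
    unfolding set_integrable_def by (rule borel_integrable_compact[OF K(1)]) auto
  then have maj: "set_integrable lborel K (\<lambda>z. norm v * B * (1 + ?g z))"
    using g by auto
  show ?thesis
    unfolding set_integrable_def
  proof (rule Bochner_Integration.integrable_bound[OF maj[unfolded set_integrable_def]])
    have "\<psi> \<in> borel_measurable lborel"
      using borel_measurable_continuous_onI[OF test_function_continuous[OF \<psi>]] by simp
    then have "(\<lambda>z. ((indicator ?H z *\<^sub>R G z) \<bullet> v) * \<psi> z) \<in> borel_measurable lborel"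
      by (rule borel_measurable_times[OF borel_measurable_inner[OF
            meas[unfolded set_borel_measurable_def] borel_measurable_const]])
    then show "(\<lambda>z. indicator ?H z *\<^sub>R ((G z \<bullet> v) * \<psi> z)) \<in> borel_measurable lborel"
      by (simp add: mult.assoc)
  next
    have "norm (indicator ?H z *\<^sub>R ((G z \<bullet> v) * \<psi> z))
        \<le> norm (indicator K z *\<^sub>R (norm v * B * (1 + ?g z)))" for z
    proof (cases "z \<in> K")
      case True
      then have pos: "height z > 0" using K(2) by (auto simp: half_space_def)
      let ?q = "norm (height z powr (a / 2) *\<^sub>R G z)"
      have "height z powr (a / 2) * height z powr (- a / 2) = 1"
        using pos by (simp flip: powr_add)
      then have "(G z \<bullet> v) * \<psi> z = ((height z powr (a / 2) *\<^sub>R G z) \<bullet> v) * ?\<chi> z"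
        by (simp add: algebra_simps)
      also have "\<bar>\<dots>\<bar> \<le> (?q * norm v) * B"
        unfolding abs_mult[of "(_ *\<^sub>R _) \<bullet> _"] by (intro mult_mono Cauchy_Schwarz_ineq2 B True) auto
      finally have "\<bar>(G z \<bullet> v) * \<psi> z\<bar> \<le> norm v * B * ?q" by (simp add: mult_ac)
      moreover have "?q \<le> 1 + ?q\<^sup>2"
      proof -
        have "0 \<le> (?q - 1/2)\<^sup>2" by simp
        then show ?thesis by (simp add: power2_eq_square algebra_simps)
      qed
      moreover have "0 \<le> B" using B[OF True] by linarith
      ultimately have "\<bar>(G z \<bullet> v) * \<psi> z\<bar> \<le> norm v * B * (1 + ?q\<^sup>2)"
        by (meson mult_left_mono mult_nonneg_nonneg norm_ge_zero order_trans)
      then show ?thesis using True by (auto simp: indicator_def)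
    qed (use K(3) in auto)
    then show "AE z in lborel. norm (indicator ?H z *\<^sub>R ((G z \<bullet> v) * \<psi> z))
        \<le> norm (indicator K z *\<^sub>R (norm v * B * (1 + ?g z)))" by simp
  qed
qed

lemma set_integral_sum:
  fixes f :: "'i \<Rightarrow> 'a \<Rightarrow> real"
  assumes "finite I" and "\<And>i. i \<in> I \<Longrightarrow> set_integrable M A (f i)"
  shows "set_integrable M A (\<lambda>x. \<Sum>i\<in>I. f i x)"
    and "(LINT x:A|M. (\<Sum>i\<in>I. f i x)) = (\<Sum>i\<in>I. LINT x:A|M. f i x)"
proof -
  have "set_integrable M A (\<lambda>x. \<Sum>i\<in>I. f i x)
      \<and> (LINT x:A|M. (\<Sum>i\<in>I. f i x)) = (\<Sum>i\<in>I. LINT x:A|M. f i x)"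
    using assms
  proof (induction I rule: finite_induct)
    case empty
    show ?case by (simp add: set_integrable_def set_lebesgue_integral_def)
  next
    case (insert i I)
    then show ?case by (simp add: set_integral_add)
  qed
  then show "set_integrable M A (\<lambda>x. \<Sum>i\<in>I. f i x)"
    and "(LINT x:A|M. (\<Sum>i\<in>I. f i x)) = (\<Sum>i\<in>I. LINT x:A|M. f i x)" by auto
qed

text \<open>
  The equation \<open>W\<^sub>t + \<Delta>W = k W / y\<^sup>2\<close> for \<open>W = y\<^bsup>a/2\<^esup> U\<close>, tested against \<open>\<theta>\<close>. It comes from the weak
  formulation with \<open>\<phi> = y\<^bsup>-a/2\<^esup> \<theta>\<close>, whose gradient term \<open>y\<^sup>a G \<bullet> \<nabla>\<phi>\<close> is moved back onto \<open>U\<close> by testing the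
  weak gradient with \<open>\<psi>\<^sub>i = y\<^sup>a \<partial>\<^sub>i\<phi>\<close>. The first-order terms in \<open>\<partial>\<^sub>i\<psi>\<^sub>i\<close> cancel for this choice of
  exponent, and what is left of the weight is the potential \<open>k / y\<^sup>2\<close>.
\<close>

lemma weak_solution_distributional:
  fixes U :: "((real ^ 'n) \<times> real) \<times> real \<Rightarrow> real"
  assumes weak: "weak_solution a T V U"
    and cont: "continuous_on (half_space \<times> {0<..<T}) U"
    and \<theta>: "test_function (half_space \<times> {0<..<T}) \<theta>"
  shows "(LINT z:half_space \<times> {0<..<T}|lborel. height z powr (a / 2) * U z *
      (frechet_derivative \<theta> (at z) (0, 1)
        - (\<Sum>i\<in>Basis. frechet_derivative (\<lambda>z. frechet_derivative \<theta> (at z) (i, 0)) (at z) (i, 0))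
        + (a / 2) * (a / 2 - 1) * \<theta> z / (height z)\<^sup>2)) = 0"
proof -
  let ?H = "half_space \<times> {0<..<T} :: (((real ^ 'n) \<times> real) \<times> real) set"
  obtain G where grad: "weak_gradient T U G" and G: "weighted_L2_loc a T G"
    and eq: "\<And>\<phi>. test_function (UNIV \<times> {0<..<T}) \<phi> \<Longrightarrow>
           (LINT z:?H|lborel. height z powr a *
               (U z * frechet_derivative \<phi> (at z) (0, 1) + frechet_derivative \<phi> (at z) (G z, 0)))
           + (LINT (x, t):UNIV \<times> {0<..<T}|lborel. V (x, t) * U ((x, 0), t) * \<phi> ((x, 0), t)) = 0"
    using weak unfolding weak_solution_def by blast
  let ?D = "\<lambda>v z. frechet_derivative \<theta> (at z) v"
  have basis: "((0, 1) :: ((real ^ 'n) \<times> real) \<times> real) \<in> Basis"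
    "\<And>i. i \<in> Basis \<Longrightarrow> ((i, 0) :: ((real ^ 'n) \<times> real) \<times> real) \<in> Basis"
    by (auto simp: Basis_prod_def)
  have D: "test_function ?H (?D (0, 1))" "\<And>i. i \<in> Basis \<Longrightarrow> test_function ?H (?D (i, 0))"
    using test_function_derivative[OF \<theta>] basis by auto
  define \<phi> where "\<phi> = (\<lambda>z. height z powr (- a / 2) * \<theta> z)"
  define \<psi> where "\<psi> i z = height z powr a * frechet_derivative \<phi> (at z) (i, 0)" for i z
  have \<phi>: "test_function ?H \<phi>"
    unfolding \<phi>_def by (rule test_function_height_powr_mult[OF \<theta>])
  have \<psi>: "test_function ?H (\<psi> i)" if "i \<in> Basis" for i
    unfolding \<psi>_def[abs_def]
    by (intro test_function_height_powr_mult test_function_derivative[OF \<phi>] basis that)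
  have t: "test_function ?H (\<lambda>z. height z powr a * frechet_derivative \<phi> (at z) (0, 1))"
    by (intro test_function_height_powr_mult test_function_derivative[OF \<phi>] basis)
  note D\<phi> = frechet_derivative_height_powr_mult[OF \<theta>, of "- a / 2", folded \<phi>_def]
  have pw: "height z powr a * (height z powr q * c) = height z powr (a + q) * c" for q c
    and z :: "((real ^ 'n) \<times> real) \<times> real"
    by (simp add: powr_add mult_ac)
  have \<psi>_eq: "\<psi> i = (\<lambda>z. - (a / 2) * snd i * (height z powr (a / 2 - 1) * \<theta> z)
      + height z powr (a / 2) * ?D (i, 0) z)" for i
  proof
    fix z :: "((real ^ 'n) \<times> real) \<times> real"
    have "\<psi> i z = - (a / 2) * snd i * (height z powr a * (height z powr (- a / 2 - 1) * \<theta> z))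
      + height z powr a * (height z powr (- a / 2) * ?D (i, 0) z)"
      unfolding \<psi>_def D\<phi> by (simp add: algebra_simps)
    also have "\<dots> = - (a / 2) * snd i * (height z powr (a / 2 - 1) * \<theta> z)
      + height z powr (a / 2) * ?D (i, 0) z"
      unfolding pw by (simp add: algebra_simps)
    finally show "\<psi> i z = - (a / 2) * snd i * (height z powr (a / 2 - 1) * \<theta> z)
      + height z powr (a / 2) * ?D (i, 0) z" .
  qed
  have D\<psi>: "frechet_derivative (\<psi> i) (at z) (i, 0)
      = height z powr (a / 2) * frechet_derivative (?D (i, 0)) (at z) (i, 0)
        - (a / 2) * (a / 2 - 1) * (snd i)\<^sup>2 * (height z powr (a / 2 - 2) * \<theta> z)"
    if "i \<in> Basis" for i z
  proof -
    have "(\<psi> i has_derivative (\<lambda>v. - (a / 2) * snd i *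
          ((a / 2 - 1) * snd (fst v) * (height z powr (a / 2 - 1 - 1) * \<theta> z)
              + height z powr (a / 2 - 1) * ?D v z)
        + ((a / 2) * snd (fst v) * (height z powr (a / 2 - 1) * ?D (i, 0) z)
           + height z powr (a / 2) * frechet_derivative (?D (i, 0)) (at z) v))) (at z)"
      unfolding \<psi>_eq
      by (intro has_derivative_add has_derivative_mult_right height_powr_mult_has_derivative[OF \<theta>]
          height_powr_mult_has_derivative[OF D(2)[OF that]])
    from frechet_derivative_at[OF this, symmetric] show ?thesis
      by (simp add: algebra_simps power2_eq_square)
  qed
  \<comment> \<open>\<open>\<phi>\<close> vanishes on \<open>{y = 0}\<close> because \<open>0 powr p = 0\<close>, so the boundary integral drops out.\<close>
  have boundary: "\<phi> ((x, 0), t) = 0" for x t by (simp add: \<phi>_def)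
  have lin: "frechet_derivative \<phi> (at z) (G z, 0)
      = (\<Sum>i\<in>Basis. (G z \<bullet> i) * frechet_derivative \<phi> (at z) (i, 0))" for z
  proof -
    let ?g = "\<lambda>x. frechet_derivative \<phi> (at z) (x, 0)"
    have "linear (\<lambda>x :: (real ^ 'n) \<times> real. (x, 0 :: real))" by (auto intro!: linearI)
    from linear_compose[OF this has_derivative_linear[OF test_function_has_derivative[OF \<phi>, of z]]]
    have g: "linear ?g" by (simp add: o_def)
    have "?g (G z) = ?g (\<Sum>i\<in>Basis. (G z \<bullet> i) *\<^sub>R i)" by (simp only: euclidean_representation)
    also have "\<dots> = (\<Sum>i\<in>Basis. (G z \<bullet> i) * ?g i)"
      by (simp only: linear_sum[OF g] linear_cmul[OF g] real_scaleR_def)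
    finally show ?thesis .
  qed
  have int_t: "set_integrable lborel ?H (\<lambda>z. U z * (height z powr a * frechet_derivative \<phi> (at z) (0, 1)))"
    by (rule set_integrable_mult_test_function[OF cont t])
  have int_G: "set_integrable lborel ?H (\<lambda>z. (G z \<bullet> i) * \<psi> i z)" if "i \<in> Basis" for i
    by (rule weighted_L2_loc_mult_test_function[OF G \<psi>[OF that]])
  have int_U: "set_integrable lborel ?H (\<lambda>z. U z * frechet_derivative (\<psi> i) (at z) (i, 0))"
    if "i \<in> Basis" for i
    by (intro set_integrable_mult_test_function cont test_function_derivative \<psi> that basis)
  have "0 = (LINT z:?H|lborel. height z powr a *
               (U z * frechet_derivative \<phi> (at z) (0, 1) + frechet_derivative \<phi> (at z) (G z, 0)))"
    using eq[OF test_function_mono[OF \<phi>]] by (simp add: boundary case_prod_unfold subset_eq)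
  also have "\<dots> = (LINT z:?H|lborel. U z * (height z powr a * frechet_derivative \<phi> (at z) (0, 1))
       + (\<Sum>i\<in>Basis. (G z \<bullet> i) * \<psi> i z))"
    unfolding lin \<psi>_def by (simp add: algebra_simps sum_distrib_left)
  also have "\<dots> = (LINT z:?H|lborel. U z * (height z powr a * frechet_derivative \<phi> (at z) (0, 1)))
       + (\<Sum>i\<in>Basis. LINT z:?H|lborel. (G z \<bullet> i) * \<psi> i z)"
    by (simp only: set_integral_add(2)[OF int_t set_integral_sum(1)[OF finite_Basis int_G]]
        set_integral_sum(2)[OF finite_Basis int_G])
  also have "(\<Sum>i\<in>Basis. LINT z:?H|lborel. (G z \<bullet> i) * \<psi> i z)
      = (\<Sum>i\<in>Basis. - (LINT z:?H|lborel. U z * frechet_derivative (\<psi> i) (at z) (i, 0)))"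
    using grad \<psi> unfolding weak_gradient_def by (intro sum.cong refl) fastforce
  also have "(LINT z:?H|lborel. U z * (height z powr a * frechet_derivative \<phi> (at z) (0, 1))) + \<dots>
     = (LINT z:?H|lborel. U z * (height z powr a * frechet_derivative \<phi> (at z) (0, 1))
         - (\<Sum>i\<in>Basis. U z * frechet_derivative (\<psi> i) (at z) (i, 0)))"
    by (simp only: set_integral_diff(2)[OF int_t set_integral_sum(1)[OF finite_Basis int_U]]
        set_integral_sum(2)[OF finite_Basis int_U] sum_negf add_uminus_conv_diff)
  also have "\<dots> = (LINT z:?H|lborel. height z powr (a / 2) * U z *
      (?D (0, 1) z - (\<Sum>i\<in>Basis. frechet_derivative (?D (i, 0)) (at z) (i, 0))
        + (a / 2) * (a / 2 - 1) * \<theta> z / (height z)\<^sup>2))"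
  proof (rule set_lebesgue_integral_cong, goal_cases)
    case 2
    show ?case
    proof (intro allI impI)
      fix z assume "z \<in> ?H"
      then have pos: "height z > 0" by (auto simp: half_space_def)
      \<comment> \<open>Only the vertical direction sees the weight; its unit vector has vertical part \<open>1\<close>.\<close>
      have sq: "(\<Sum>i\<in>(Basis :: ((real ^ 'n) \<times> real) set). (snd i)\<^sup>2) = 1"
      proof -
        have "(\<Sum>i\<in>(Basis :: ((real ^ 'n) \<times> real) set). (snd i)\<^sup>2)
          = (\<Sum>i\<in>(Basis :: ((real ^ 'n) \<times> real) set). ((0, 1) \<bullet> i) * ((0, 1) \<bullet> i))"
          by (intro sum.cong) (auto simp: inner_prod_def power2_eq_square)
        also have "\<dots> = (0, 1 :: real) \<bullet> (0 :: real ^ 'n, 1 :: real)" by (rule euclidean_inner[symmetric])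
        finally show ?thesis by simp
      qed
      have p: "height z powr (a / 2 - 2) = height z powr (a / 2) / (height z)\<^sup>2"
        using pos by (simp add: powr_diff)
      have "(\<Sum>i\<in>Basis. U z * frechet_derivative (\<psi> i) (at z) (i, 0))
         = (\<Sum>i\<in>Basis. height z powr (a / 2) * U z * frechet_derivative (?D (i, 0)) (at z) (i, 0)
            - (snd i)\<^sup>2 * (U z * (a / 2) * (a / 2 - 1) * (height z powr (a / 2 - 2) * \<theta> z)))"
        by (intro sum.cong refl) (simp add: D\<psi> field_simps)
      also have "\<dots> = height z powr (a / 2) * U z * (\<Sum>i\<in>Basis. frechet_derivative (?D (i, 0)) (at z) (i, 0))
          - U z * (a / 2) * (a / 2 - 1) * (height z powr (a / 2 - 2) * \<theta> z)"
        by (simp only: sum_subtractf sum_distrib_left[symmetric] sum_distrib_right[symmetric] sq mult_1_left)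
      finally have lap: "(\<Sum>i\<in>Basis. U z * frechet_derivative (\<psi> i) (at z) (i, 0)) = \<dots>" .
      have "height z powr a * frechet_derivative \<phi> (at z) (0, 1) = height z powr (a / 2) * ?D (0, 1) z"
        unfolding D\<phi> by (simp add: pw)
      then show "U z * (height z powr a * frechet_derivative \<phi> (at z) (0, 1))
         - (\<Sum>i\<in>Basis. U z * frechet_derivative (\<psi> i) (at z) (i, 0)) =
        height z powr (a / 2) * U z *
        (?D (0, 1) z - (\<Sum>i\<in>Basis. frechet_derivative (?D (i, 0)) (at z) (i, 0))
          + (a / 2) * (a / 2 - 1) * \<theta> z / (height z)\<^sup>2)"
        unfolding lap p using pos by (simp add: field_simps)
    qed
  next
    case 1
    show ?case using borel_open[OF open_Times[OF open_half_space open_greaterThanLessThan]] by simp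
  qed
  finally show ?thesis by simp
qed

section \<open>The energy inequality for backward heat equations\<close>

text \<open>
  Differentiability along a single direction with continuous derivative. Slices of a function on
  space-time, mollifications and the cutoffs below are handled through this notion, which
  avoids total derivatives.
\<close>

definition has_partial :: "'e::euclidean_space \<Rightarrow> ('e \<Rightarrow> real) \<Rightarrow> ('e \<Rightarrow> real) \<Rightarrow> bool" where
  "has_partial b f f' \<longleftrightarrow> continuous_on UNIV f \<and> continuous_on UNIV f' \<and>
     (\<forall>z. ((\<lambda>h. f (z + h *\<^sub>R b)) has_real_derivative f' z) (at 0))"

lemma has_partial_continuous:
  assumes "has_partial b f f'"
  shows "continuous_on A f" "continuous_on A f'"
  using assms unfolding has_partial_def by (auto intro: continuous_on_subset)

lemma has_partial_at:
  assumes "has_partial b f f'"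
  shows "((\<lambda>h. f (z + h *\<^sub>R b)) has_real_derivative f' (z + h *\<^sub>R b)) (at h)"
proof -
  have "((\<lambda>k. f ((z + h *\<^sub>R b) + k *\<^sub>R b)) has_real_derivative f' (z + h *\<^sub>R b)) (at 0)"
    using assms unfolding has_partial_def by blast
  then have "((\<lambda>k. f (z + (h + k) *\<^sub>R b)) has_real_derivative f' (z + h *\<^sub>R b)) (at 0)"
    by (simp add: scaleR_add_left add.assoc)
  then show ?thesis
    using DERIV_shift[of "\<lambda>h. f (z + h *\<^sub>R b)" "f' (z + h *\<^sub>R b)" 0 h] by (simp add: add.commute)
qed

lemma has_partial_mult:
  assumes "has_partial b f f'" and "has_partial b g g'"
  shows "has_partial b (\<lambda>z. f z * g z) (\<lambda>z. f z * g' z + f' z * g z)"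
  using assms unfolding has_partial_def
  by (auto intro!: continuous_intros derivative_eq_intros)

lemma C_k_has_partial:
  assumes "C_k (Suc (Suc k)) f" and "b \<in> Basis"
  shows "has_partial b f (\<lambda>z. frechet_derivative f (at z) b)"
  unfolding has_partial_def
proof (intro conjI allI)
  show "continuous_on UNIV f" using assms(1) by (rule C_k_continuous)
  show "continuous_on UNIV (\<lambda>z. frechet_derivative f (at z) b)"
    using assms by (intro C_k_continuous[of "Suc k"]) auto
  fix z
  have line: "((\<lambda>h. z + h *\<^sub>R b) has_derivative (\<lambda>h. h *\<^sub>R b)) (at 0)"
    by (auto intro!: derivative_eq_intros)
  from has_derivative_compose[OF line C_k_has_derivative[OF assms(1)]]
  have "((\<lambda>h. f (z + h *\<^sub>R b)) has_derivative (\<lambda>h. frechet_derivative f (at z) (h *\<^sub>R b))) (at 0)"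
    by simp
  moreover have "linear (frechet_derivative f (at z))"
    by (rule has_derivative_linear[OF C_k_has_derivative[OF assms(1)]])
  ultimately show "((\<lambda>h. f (z + h *\<^sub>R b)) has_real_derivative frechet_derivative f (at z) b) (at 0)"
    unfolding has_field_derivative_def by (simp add: linear_cmul mult.commute[of _ "frechet_derivative f (at z) b"])
qed

lemma has_integral_shift_support:
  fixes f :: "'e::euclidean_space \<Rightarrow> real"
  assumes "(f has_integral i) (cbox p q)" and "\<And>x. x \<notin> cbox p q \<Longrightarrow> f x = 0"
    and "cbox (p - c) (q - c) \<subseteq> B"
  shows "((\<lambda>x. f (x + c)) has_integral i) B"
proof (rule has_integral_on_superset[OF _ _ assms(3)])
  show "((\<lambda>x. f (x + c)) has_integral i) (cbox (p - c) (q - c))"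
    using has_integral_affinity'[OF assms(1), of 1 c] by simp
  fix x assume "x \<notin> cbox (p - c) (q - c)"
  then have "x + c \<notin> cbox p q" by (auto simp: mem_box algebra_simps)
  then show "f (x + c) = 0" by (rule assms(2))
qed

text \<open>
  Integration by parts: the integral of \<open>f (x + h b)\<close> over a large box does not depend on small \<open>h\<close>,
  by translation invariance, and its derivative at \<open>h = 0\<close> is the integral of \<open>f'\<close>.
\<close>

lemma integral_has_partial_eq_0:
  fixes f :: "'e::euclidean_space \<Rightarrow> real"
  assumes f: "has_partial b f f'" and b: "b \<in> Basis"
    and supp: "\<And>x. x \<notin> cbox p q \<Longrightarrow> f x = 0" "\<And>x. x \<notin> cbox p q \<Longrightarrow> f' x = 0"
  shows "integral (cbox p q) f' = 0"
proof -
  \<comment> \<open>Room for translations by \<open>h b\<close> with \<open>\<bar>h\<bar> \<le> 1\<close>.\<close>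
  define P where "P = p - One"
  define Q where "Q = q + One"
  have sub: "cbox (p - h *\<^sub>R b) (q - h *\<^sub>R b) \<subseteq> cbox P Q" if "h \<in> {-1..1}" for h
  proof -
    have "\<bar>(h *\<^sub>R b) \<bullet> i\<bar> \<le> 1" if "i \<in> Basis" for i
      using \<open>h \<in> {-1..1}\<close> b that by (auto simp: inner_Basis)
    then show ?thesis
      unfolding P_def Q_def subset_box by (fastforce simp: inner_diff_left inner_add_left)
  qed
  have "(f has_integral integral (cbox p q) f) (cbox p q)"
    by (intro integrable_integral integrable_continuous has_partial_continuous[OF f])
  from has_integral_shift_support[OF this supp(1) sub]
  have const: "integral (cbox P Q) (\<lambda>x. f (x + h *\<^sub>R b)) = integral (cbox p q) f"
    if "h \<in> {-1..1}" for h using that by (simp add: integral_unique)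
  have "((\<lambda>h. integral (cbox P Q) (\<lambda>x. f (x + h *\<^sub>R b))) has_real_derivative
      integral (cbox P Q) (\<lambda>x. f' (x + 0 *\<^sub>R b))) (at 0 within {-1..1})"
  proof (rule leibniz_rule_field_derivative)
    fix h x
    show "((\<lambda>h. f (x + h *\<^sub>R b)) has_real_derivative f' (x + h *\<^sub>R b)) (at h within {-1..1})"
      by (rule has_field_derivative_at_within[OF has_partial_at[OF f]])
    show "(\<lambda>x. f (x + h *\<^sub>R b)) integrable_on cbox P Q"
      by (intro integrable_continuous continuous_on_compose2[OF has_partial_continuous(1)[OF f, of UNIV]]
          continuous_intros) auto
  next
    show "continuous_on ({- 1..1} \<times> cbox P Q) (\<lambda>(h, x). f' (x + h *\<^sub>R b))"
      unfolding case_prod_unfold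
      by (intro continuous_on_compose2[OF has_partial_continuous(2)[OF f, of UNIV]]
          continuous_intros) auto
  qed auto
  moreover have "at (0::real) within {-1..1} = at 0" by (rule at_within_interior) auto
  ultimately have "((\<lambda>h. integral (cbox P Q) (\<lambda>x. f (x + h *\<^sub>R b))) has_real_derivative
      integral (cbox P Q) f') (at 0)" by simp
  moreover have "((\<lambda>h. integral (cbox P Q) (\<lambda>x. f (x + h *\<^sub>R b))) has_real_derivative 0) (at 0)"
    by (rule has_field_derivative_transform_within_open[of "\<lambda>h. integral (cbox p q) f" _ _ "{-1<..<1}"])
       (use const in auto)
  ultimately have "integral (cbox P Q) f' = 0" by (rule DERIV_unique)
  moreover have "integral (cbox P Q) f' = integral (cbox p q) f'"
    using sub[of 0] supp(2)
    by (intro integral_unique has_integral_on_superset[OF integrable_integral])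
       (auto intro!: integrable_continuous has_partial_continuous[OF f])
  ultimately show ?thesis by simp
qed

text \<open>
  The sign of \<open>\<Delta>w\<close> in \<open>w\<^sub>t = g - \<Delta>w\<close> makes \<open>\<integral> w\<^sup>2 \<phi>\<^sup>2\<close> almost increasing: after integration by parts in
  each direction, \<open>(\<partial>\<^sub>iw)\<^sup>2 \<phi>\<^sup>2 + 2 w \<phi> \<partial>\<^sub>i\<phi> \<partial>\<^sub>iw = (w \<partial>\<^sub>i\<phi> + \<phi> \<partial>\<^sub>iw)\<^sup>2 - w\<^sup>2 (\<partial>\<^sub>i\<phi>)\<^sup>2 \<ge> - A\<^sup>2 K\<^sup>2\<close>. No bound on
  derivatives of \<open>w\<close> enters the rate, so it passes to limits of \<open>w\<close>.
\<close>

lemma energy_inequality: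
  fixes w :: "'e::euclidean_space \<times> real \<Rightarrow> real"
  assumes wt: "has_partial (0, 1) w wt"
    and wi: "\<And>i. i \<in> Basis \<Longrightarrow> has_partial (i, 0) w (wi i)"
    and wii: "\<And>i. i \<in> Basis \<Longrightarrow> has_partial (i, 0) (wi i) (wii i)"
    and \<phi>: "\<And>i. i \<in> Basis \<Longrightarrow> has_partial i \<phi> (\<phi>i i)"
    and supp: "\<And>X. X \<notin> cbox p q \<Longrightarrow> \<phi> X = 0"
    and wA: "\<And>X t. X \<in> cbox p q \<Longrightarrow> t1 \<le> t \<Longrightarrow> t \<le> t2 \<Longrightarrow> \<bar>w (X, t)\<bar> \<le> A"
    and gB: "\<And>X t. X \<in> cbox p q \<Longrightarrow> t1 \<le> t \<Longrightarrow> t \<le> t2 \<Longrightarrow>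
        \<bar>wt (X, t) + (\<Sum>i\<in>Basis. wii i (X, t))\<bar> \<le> B"
    and \<phi>K: "\<And>X. X \<in> cbox p q \<Longrightarrow> \<bar>\<phi> X\<bar> \<le> K"
    and \<phi>iK: "\<And>X i. X \<in> cbox p q \<Longrightarrow> i \<in> Basis \<Longrightarrow> \<bar>\<phi>i i X\<bar> \<le> K"
    and t: "t1 \<le> t2"
  shows "integral (cbox p q) (\<lambda>X. (w (X, t2))\<^sup>2 * (\<phi> X)\<^sup>2)
    \<ge> integral (cbox p q) (\<lambda>X. (w (X, t1))\<^sup>2 * (\<phi> X)\<^sup>2)
      - (2 * real DIM('e) * A\<^sup>2 * K\<^sup>2 + 2 * A * B * K\<^sup>2) * measure lborel (cbox p q) * (t2 - t1)"
proof (cases "cbox p q = {}")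
  case True
  then show ?thesis by simp
next
  case False
  then obtain X0 where X0: "X0 \<in> cbox p q" by blast
  have nonneg: "0 \<le> A" "0 \<le> B" "0 \<le> K"
    using wA[OF X0 order_refl t] gB[OF X0 order_refl t] \<phi>K[OF X0] by linarith+
  obtain i0 where "i0 \<in> (Basis :: 'e set)" using nonempty_Basis by blast
  note c\<phi> = has_partial_continuous(1)[OF \<phi>[OF this]]
  define L where "L = 2 * real DIM('e) * A\<^sup>2 * K\<^sup>2 + 2 * A * B * K\<^sup>2"
  define J where "J t = integral (cbox p q) (\<lambda>X. (w (X, t))\<^sup>2 * (\<phi> X)\<^sup>2)" for t
  have cslice: "continuous_on S (\<lambda>X. f (X, t))" if "continuous_on UNIV f"
    for S t and f :: "'e \<times> real \<Rightarrow> real"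
    by (rule continuous_on_compose2[OF that]) (auto intro!: continuous_intros)
  have J': "(J has_real_derivative integral (cbox p q) (\<lambda>X. 2 * w (X, t) * wt (X, t) * (\<phi> X)\<^sup>2)) (at t)"
    for t
    unfolding J_def[abs_def]
  proof (rule leibniz_rule_field_derivative[where U = UNIV, simplified])
    fix t X
    have "((\<lambda>h. w ((X, 0) + h *\<^sub>R (0, 1))) has_real_derivative wt ((X, 0) + t *\<^sub>R (0, 1))) (at t)"
      by (rule has_partial_at[OF wt])
    then have "((\<lambda>h. w (X, h)) has_real_derivative wt (X, t)) (at t)" by simp
    then show "((\<lambda>h. (w (X, h))\<^sup>2 * (\<phi> X)\<^sup>2) has_real_derivative 2 * w (X, t) * wt (X, t) * (\<phi> X)\<^sup>2) (at t)"
      by (auto intro!: derivative_eq_intros)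
  next
    show "(\<lambda>X. (w (X, t))\<^sup>2 * (\<phi> X)\<^sup>2) integrable_on cbox p q" for t
      by (intro integrable_continuous continuous_intros cslice has_partial_continuous[OF wt] c\<phi>)
    have "continuous_on (UNIV \<times> cbox p q) (\<lambda>x. w (snd x, fst x))"
      "continuous_on (UNIV \<times> cbox p q) (\<lambda>x. wt (snd x, fst x))"
      "continuous_on (UNIV \<times> cbox p q) (\<lambda>x. \<phi> (snd x))"
      by (intro continuous_on_compose2[OF has_partial_continuous(1)[OF wt, of UNIV]]
          continuous_on_compose2[OF has_partial_continuous(2)[OF wt, of UNIV]]
          continuous_on_compose2[OF c\<phi>[of UNIV]] continuous_intros; simp)+
    then show "continuous_on (UNIV \<times> cbox p q) (\<lambda>(t, X). 2 * w (X, t) * wt (X, t) * (\<phi> X)\<^sup>2)"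
      unfolding case_prod_unfold by (intro continuous_intros)
  qed
  have lower: "integral (cbox p q) (\<lambda>X. 2 * w (X, t) * wt (X, t) * (\<phi> X)\<^sup>2) \<ge> - L * measure lborel (cbox p q)"
    if t: "t1 \<le> t" "t \<le> t2" for t
  proof -
    have slice: "has_partial i (\<lambda>X. f (X, t)) (\<lambda>X. f' (X, t))"
      if "has_partial (i, 0) f f'" for i :: 'e and f f'
      unfolding has_partial_def
    proof (intro conjI allI cslice has_partial_continuous[OF that])
      fix X
      show "((\<lambda>h. f (X + h *\<^sub>R i, t)) has_real_derivative f' (X, t)) (at 0)"
        using has_partial_at[OF that, of "(X, t)" 0] by simp
    qed
    \<comment> \<open>\<open>E i\<close> is \<open>\<partial>\<^sub>i(w \<phi>\<^sup>2 \<partial>\<^sub>iw)\<close>: it integrates to \<open>0\<close> and contains \<open>w \<phi>\<^sup>2 \<partial>\<^sub>i\<partial>\<^sub>iw\<close>, so adding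
      it trades the Laplacian for squares of first derivatives.\<close>
    define E where "E i X = ((w (X, t) * (\<phi> X * \<phi> X)) * wii i (X, t)
        + (w (X, t) * (\<phi> X * \<phi>i i X + \<phi>i i X * \<phi> X) + wi i (X, t) * (\<phi> X * \<phi> X)) * wi i (X, t))" for i X
    have P: "has_partial i (\<lambda>X. (w (X, t) * (\<phi> X * \<phi> X)) * wi i (X, t)) (E i)" if "i \<in> Basis" for i
      unfolding E_def[abs_def]
      by (intro has_partial_mult \<phi> slice[OF wi] slice[OF wii] that)
    have int0: "integral (cbox p q) (E i) = 0" if "i \<in> Basis" for i
      by (rule integral_has_partial_eq_0[OF P[OF that] that]) (simp_all add: supp E_def)
    have intE: "E i integrable_on cbox p q" if "i \<in> Basis" for i
      by (intro integrable_continuous has_partial_continuous[OF P[OF that]])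
    have int1: "(\<lambda>X. 2 * w (X, t) * wt (X, t) * (\<phi> X)\<^sup>2) integrable_on cbox p q"
      by (intro integrable_continuous continuous_intros cslice has_partial_continuous[OF wt] c\<phi>)
    have "- L * measure lborel (cbox p q) = integral (cbox p q) (\<lambda>X. - L)" by simp
    also have "\<dots> \<le> integral (cbox p q) (\<lambda>X. 2 * w (X, t) * wt (X, t) * (\<phi> X)\<^sup>2 + 2 * (\<Sum>i\<in>Basis. E i X))"
    proof (rule integral_le)
      show "(\<lambda>X. 2 * w (X, t) * wt (X, t) * (\<phi> X)\<^sup>2 + 2 * (\<Sum>i\<in>Basis. E i X)) integrable_on cbox p q"
        by (intro integrable_add int1 integrable_on_mult_right integrable_sum finite_Basis intE)
      fix X assume X: "X \<in> cbox p q"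
      have w2: "(w (X, t))\<^sup>2 \<le> A\<^sup>2" using wA[OF X t] nonneg by (simp add: abs_le_square_iff[symmetric])
      have \<phi>2: "(\<phi> X)\<^sup>2 \<le> K\<^sup>2" using \<phi>K[OF X] nonneg by (simp add: abs_le_square_iff[symmetric])
      have E: "E i X \<ge> w (X, t) * (\<phi> X)\<^sup>2 * wii i (X, t) - A\<^sup>2 * K\<^sup>2" if "i \<in> Basis" for i
      proof -
        have "(\<phi>i i X)\<^sup>2 \<le> K\<^sup>2" using \<phi>iK[OF X that] nonneg by (simp add: abs_le_square_iff[symmetric])
        then have "(w (X, t))\<^sup>2 * (\<phi>i i X)\<^sup>2 \<le> A\<^sup>2 * K\<^sup>2" using w2 by (intro mult_mono) auto
        moreover have "0 \<le> (w (X, t) * \<phi>i i X + \<phi> X * wi i (X, t))\<^sup>2" by simp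
        ultimately show ?thesis by (simp add: E_def power2_eq_square algebra_simps)
      qed
      have "(\<Sum>i\<in>Basis. E i X) \<ge> (\<Sum>i\<in>Basis. w (X, t) * (\<phi> X)\<^sup>2 * wii i (X, t) - A\<^sup>2 * K\<^sup>2)"
        by (intro sum_mono E)
      then have "(\<Sum>i\<in>Basis. E i X) \<ge> w (X, t) * (\<phi> X)\<^sup>2 * (\<Sum>i\<in>Basis. wii i (X, t)) - real DIM('e) * (A\<^sup>2 * K\<^sup>2)"
        by (simp add: sum_subtractf sum_distrib_left)
      moreover have "\<bar>w (X, t) * (wt (X, t) + (\<Sum>i\<in>Basis. wii i (X, t))) * (\<phi> X)\<^sup>2\<bar> \<le> A * B * K\<^sup>2"
        unfolding abs_mult using wA[OF X t] gB[OF X t] \<phi>2 nonneg by (intro mult_mono) auto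
      ultimately show "- L \<le> 2 * w (X, t) * wt (X, t) * (\<phi> X)\<^sup>2 + 2 * (\<Sum>i\<in>Basis. E i X)"
        unfolding L_def by (simp add: algebra_simps abs_le_iff)
    qed auto
    also have "\<dots> = integral (cbox p q) (\<lambda>X. 2 * w (X, t) * wt (X, t) * (\<phi> X)\<^sup>2)"
    proof -
      have "integral (cbox p q) (\<lambda>X. \<Sum>i\<in>Basis. E i X) = 0"
        by (simp add: integral_sum intE int0)
      then show ?thesis
        by (subst integral_add) (auto intro!: int1 integrable_on_mult_right integrable_sum intE)
    qed
    finally show ?thesis .
  qed
  have "J t1 + L * measure lborel (cbox p q) * t1 \<le> J t2 + L * measure lborel (cbox p q) * t2"
  proof (rule DERIV_nonneg_imp_nondecreasing[OF t])
    fix t assume "t1 \<le> t" "t \<le> t2"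
    then show "\<exists>y. ((\<lambda>t. J t + L * measure lborel (cbox p q) * t) has_real_derivative y) (at t) \<and> 0 \<le> y"
      using lower[of t] by (intro exI[of _ "integral (cbox p q) (\<lambda>X. 2 * w (X, t) * wt (X, t) * (\<phi> X)\<^sup>2) + L * measure lborel (cbox p q)"])
        (auto intro!: derivative_eq_intros J' simp: algebra_simps)
  qed
  then show ?thesis unfolding J_def L_def by (simp add: algebra_simps)
qed

section \<open>Mollification and the interior energy inequality\<close>

lemma convolution_has_partial:
  fixes F :: "'e::euclidean_space \<Rightarrow> real"
  assumes F: "continuous_on (cbox c d) F" and \<theta>: "has_partial b \<theta> \<theta>'"
  shows "has_partial b (\<lambda>y. integral (cbox c d) (\<lambda>z. F z * \<theta> (z - y)))
     (\<lambda>y. - integral (cbox c d) (\<lambda>z. F z * \<theta>' (z - y)))"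
proof -
  have joint: "continuous_on (UNIV \<times> cbox c d) (\<lambda>(y, z). F z * f (z - y))"
    if "continuous_on UNIV f" for f
    unfolding case_prod_unfold
    by (intro continuous_intros continuous_on_compose2[OF F] continuous_on_compose2[OF that]) auto
  have cont: "continuous_on (cbox c d) (\<lambda>z. F z * f (z - y))" if "continuous_on UNIV f" for f y
    by (intro continuous_intros F continuous_on_compose2[OF that]) auto
  note c\<theta> = has_partial_continuous[OF \<theta>, of UNIV]
  show ?thesis
    unfolding has_partial_def
  proof (intro conjI allI)
    show "continuous_on UNIV (\<lambda>y. integral (cbox c d) (\<lambda>z. F z * \<theta> (z - y)))"
      by (rule integral_continuous_on_param[OF joint[OF c\<theta>(1)]])
    show "continuous_on UNIV (\<lambda>y. - integral (cbox c d) (\<lambda>z. F z * \<theta>' (z - y)))"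
      by (intro continuous_on_minus integral_continuous_on_param[OF joint[OF c\<theta>(2)]])
    fix y
    have "((\<lambda>h. integral (cbox c d) (\<lambda>z. F z * \<theta> (z - (y + h *\<^sub>R b)))) has_real_derivative
        integral (cbox c d) (\<lambda>z. - (F z * \<theta>' (z - (y + 0 *\<^sub>R b))))) (at 0)"
    proof (rule leibniz_rule_field_derivative[where U = UNIV, simplified])
      fix h z
      have "((\<lambda>h. \<theta> ((z - y) + (- h) *\<^sub>R b)) has_real_derivative \<theta>' ((z - y) + (- h) *\<^sub>R b) * (- 1)) (at h)"
        by (rule DERIV_chain2[OF has_partial_at[OF \<theta>]]) (auto intro!: derivative_eq_intros)
      then have "((\<lambda>h. \<theta> (z - (y + h *\<^sub>R b))) has_real_derivative - \<theta>' (z - (y + h *\<^sub>R b))) (at h)"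
        by (simp add: algebra_simps)
      then show "((\<lambda>h. F z * \<theta> (z - (y + h *\<^sub>R b))) has_real_derivative
          - (F z * \<theta>' (z - (y + h *\<^sub>R b)))) (at h)"
        by (auto intro!: derivative_eq_intros)
    next
      show "(\<lambda>z. F z * \<theta> (z - (y + h *\<^sub>R b))) integrable_on cbox c d" for h
        by (rule integrable_continuous[OF cont[OF c\<theta>(1)]])
      have "continuous_on (UNIV \<times> cbox c d) (\<lambda>x. F (snd x) * \<theta>' (snd x - (y + fst x *\<^sub>R b)))"
        by (intro continuous_intros continuous_on_compose2[OF F] continuous_on_compose2[OF c\<theta>(2)]) auto
      then show "continuous_on (UNIV \<times> cbox c d) (\<lambda>(h, z). - (F z * \<theta>' (z - (y + h *\<^sub>R b))))"
        unfolding case_prod_unfold by (rule continuous_on_minus)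
    qed
    then show "((\<lambda>h. integral (cbox c d) (\<lambda>z. F z * \<theta> (z - (y + h *\<^sub>R b)))) has_real_derivative
        - integral (cbox c d) (\<lambda>z. F z * \<theta>' (z - y))) (at 0)"
      by simp
  qed
qed

text \<open>
  The last clause says that \<open>\<eta>\<close> has integral \<open>1\<close>; it is stated for every box containing the
  translated support because convolutions are taken over boxes.
\<close>

definition mollifier :: "real \<Rightarrow> ('e::euclidean_space \<Rightarrow> real) \<Rightarrow> bool" where
  "mollifier e \<eta> \<longleftrightarrow> (\<forall>k. C_k k \<eta>) \<and> (\<forall>z. 0 \<le> \<eta> z) \<and> (\<forall>z. norm z \<ge> e \<longrightarrow> \<eta> z = 0) \<and>
     (\<forall>c d y. cball y e \<subseteq> cbox c d \<longrightarrow> ((\<lambda>z. \<eta> (z - y)) has_integral 1) (cbox c d))"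

lemma mollifier_eq_0:
  assumes "mollifier e \<eta>" and "z \<notin> cball y e"
  shows "\<eta> (z - y) = 0"
proof -
  have "norm (z - y) \<ge> e" using assms(2) by (simp add: dist_norm norm_minus_commute)
  then show ?thesis using assms(1) unfolding mollifier_def by blast
qed

lemma mollifier_exists:
  assumes e: "e > 0"
  obtains \<eta> :: "'e::euclidean_space \<Rightarrow> real" where "mollifier e \<eta>"
proof -
  let ?b = "bump e :: 'e \<Rightarrow> real"
  define P where "P = - (e *\<^sub>R (One :: 'e))"
  define Q where "Q = e *\<^sub>R (One :: 'e)"
  define N where "N = integral (cbox P Q) ?b"
  have b: "continuous_on A ?b" for A
    using C_k_continuous[OF C_k_bump] continuous_on_subset by blast
  then have "?b integrable_on cbox P Q" by (intro integrable_continuous)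
  then have N: "(?b has_integral N) (cbox P Q)" unfolding N_def by (rule integrable_integral)
  have "N \<ge> 0" by (rule has_integral_nonneg[OF N]) (rule bump_nonneg)
  moreover have "N \<noteq> 0"
  proof
    assume "N = 0"
    then have "?b 0 = 0"
      using e N b by (intro has_integral_0_cbox_imp_0[of P Q ?b 0])
        (auto simp: bump_nonneg P_def Q_def mem_box box_ne_empty)
    then show False using bump_pos_iff[OF e, of "0 :: 'e"] e by simp
  qed
  ultimately have "N > 0" by simp
  define \<eta> where "\<eta> z = ?b z / N" for z
  have \<eta>1: "(\<eta> has_integral 1) (cbox P Q)"
    using has_integral_divide[OF N, of N] \<open>N > 0\<close> unfolding \<eta>_def[abs_def] by simp
  have supp: "\<eta> z = 0" if "norm z \<ge> e" for z
    using bump_eq_0[OF e that] by (simp add: \<eta>_def)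
  have off: "\<eta> z = 0" if "z \<notin> cbox P Q" for z
  proof (rule supp, rule ccontr)
    assume "\<not> e \<le> norm z"
    then have "\<bar>z \<bullet> i\<bar> \<le> e" if "i \<in> Basis" for i using Basis_le_norm[OF that, of z] by linarith
    then have "z \<in> cbox P Q" by (force simp: P_def Q_def mem_box abs_le_iff)
    then show False using that by simp
  qed
  have "((\<lambda>z. \<eta> (z - y)) has_integral 1) (cbox c d)" if sub: "cball y e \<subseteq> cbox c d" for c d y
  proof -
    \<comment> \<open>A box containing the ball contains the smallest cube around the ball.\<close>
    have "cbox (P - (- y)) (Q - (- y)) \<subseteq> cbox c d"
    proof -
      have "c \<bullet> i \<le> y \<bullet> i - e" "y \<bullet> i + e \<le> d \<bullet> i" if i: "i \<in> Basis" for i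
      proof -
        have "y - e *\<^sub>R i \<in> cball y e" "y + e *\<^sub>R i \<in> cball y e"
          using e i by (auto simp: dist_norm)
        then have "y - e *\<^sub>R i \<in> cbox c d" "y + e *\<^sub>R i \<in> cbox c d" using sub by blast+
        then show "c \<bullet> i \<le> y \<bullet> i - e" "y \<bullet> i + e \<le> d \<bullet> i"
          using i unfolding mem_box by (auto simp: inner_diff_left inner_add_left dest!: bspec[OF _ i])
      qed
      then show ?thesis
        by (auto simp: subset_box P_def Q_def inner_diff_left inner_add_left inner_minus_left add.commute)
    qed
    from has_integral_shift_support[OF \<eta>1 off this] show ?thesis by simp
  qed
  then have "mollifier e \<eta>"
    using supp bump_nonneg[of e] \<open>N > 0\<close> C_k_cmult[OF C_k_bump, of _ "1 / N" e]
    unfolding mollifier_def \<eta>_def[abs_def] by (auto intro!: divide_nonneg_pos bump_nonneg)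
  then show ?thesis by (rule that)
qed

lemma mollifier_average_bound:
  assumes \<eta>: "mollifier e \<eta>" and f: "continuous_on (cbox c d) f"
    and y: "cball y e \<subseteq> cbox c d" and C: "\<And>z. z \<in> cball y e \<Longrightarrow> \<bar>f z\<bar> \<le> C"
  shows "\<bar>integral (cbox c d) (\<lambda>z. f z * \<eta> (z - y))\<bar> \<le> C"
proof -
  have \<eta>1: "((\<lambda>z. \<eta> (z - y)) has_integral 1) (cbox c d)"
    using \<eta> y unfolding mollifier_def by blast
  have "continuous_on UNIV \<eta>" using \<eta> C_k_continuous unfolding mollifier_def by blast
  then have c\<eta>: "continuous_on (cbox c d) (\<lambda>z. \<eta> (z - y))"
    by (rule continuous_on_compose2) (auto intro!: continuous_intros)
  have "norm (integral (cbox c d) (\<lambda>z. f z * \<eta> (z - y))) \<le> integral (cbox c d) (\<lambda>z. C * \<eta> (z - y))"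
  proof (rule integral_norm_bound_integral)
    fix z assume "z \<in> cbox c d"
    show "norm (f z * \<eta> (z - y)) \<le> C * \<eta> (z - y)"
    proof (cases "z \<in> cball y e")
      case True
      then show ?thesis using C[OF True] \<eta> unfolding mollifier_def
        by (simp add: abs_mult mult_right_mono)
    next
      case False
      then have "\<eta> (z - y) = 0" by (rule mollifier_eq_0[OF \<eta>])
      then show ?thesis by simp
    qed
  qed (intro integrable_continuous continuous_intros f c\<eta>)+
  also have "\<dots> = C" using integral_unique[OF \<eta>1] by simp
  finally show ?thesis by simp
qed

text \<open>
  The energy inequality for \<open>W\<close> on a box at height at least \<open>\<delta>\<close>. On the box enlarged by \<open>\<delta>/2\<close> one has
  \<open>\<bar>W\<bar> \<le> A\<close> and \<open>\<bar>k W / y\<^sup>2\<bar> \<le> B\<close>, as \<open>a \<le> 0\<close> makes \<open>y\<^bsup>a/2\<^esup>\<close> non-increasing. Averages obey the same bounds, so the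
  inequality holds for mollifications of \<open>W\<close> with a common rate, and these converge to \<open>W\<close> uniformly
  on the box.
\<close>

lemma interior_energy_inequality:
  fixes U :: "((real ^ 'n) \<times> real) \<times> real \<Rightarrow> real" and p q :: "(real ^ 'n) \<times> real"
    and a :: real
  defines "W \<equiv> \<lambda>z. height z powr (a / 2) * U z"
  assumes weak: "weak_solution a T V U" and a: "a \<le> 0"
    and cont: "continuous_on (half_space \<times> {0<..<T}) U"
    and bounded: "\<And>z. z \<in> half_space \<times> {0<..<T} \<Longrightarrow> \<bar>U z\<bar> \<le> C0"
    and \<delta>: "0 < \<delta>" "\<delta> \<le> snd p"
    and \<phi>: "\<And>i. i \<in> Basis \<Longrightarrow> has_partial i \<phi> (\<phi>i i)"
    and supp: "\<And>X. X \<notin> cbox p q \<Longrightarrow> \<phi> X = 0"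
    and \<phi>K: "\<And>X. X \<in> cbox p q \<Longrightarrow> \<bar>\<phi> X\<bar> \<le> K"
    and \<phi>iK: "\<And>X i. X \<in> cbox p q \<Longrightarrow> i \<in> Basis \<Longrightarrow> \<bar>\<phi>i i X\<bar> \<le> K"
    and t: "0 < t1" "t1 \<le> t2" "t2 < T"
    and A: "A = (\<delta> / 2) powr (a / 2) * C0"
    and B: "B = \<bar>(a / 2) * (a / 2 - 1)\<bar> * A / (\<delta> / 2)\<^sup>2"
  shows "integral (cbox p q) (\<lambda>X. (W (X, t2))\<^sup>2 * (\<phi> X)\<^sup>2)
    \<ge> integral (cbox p q) (\<lambda>X. (W (X, t1))\<^sup>2 * (\<phi> X)\<^sup>2)
      - (2 * real DIM((real ^ 'n) \<times> real) * A\<^sup>2 * K\<^sup>2 + 2 * A * B * K\<^sup>2)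
          * measure lborel (cbox p q) * (t2 - t1)"
proof (cases "cbox p q = {}")
  case True
  then show ?thesis by simp
next
  case False
  then obtain X0 where X0: "X0 \<in> cbox p q" by blast
  let ?H = "half_space \<times> {0<..<T} :: (((real ^ 'n) \<times> real) \<times> real) set"
  let ?k = "(a / 2) * (a / 2 - 1)"
  \<comment> \<open>Mollification radii up to \<open>e0\<close> stay in the equation's domain and above height \<open>\<delta>/2\<close>.\<close>
  define e0 where "e0 = Min {\<delta> / 2, t1 / 2, (T - t2) / 2}"
  have e0: "e0 > 0" "e0 \<le> \<delta> / 2" "e0 \<le> t1 / 2" "e0 \<le> (T - t2) / 2"
    unfolding e0_def using \<delta> t by (simp_all add: min_less_iff_disj min_def)
  define c where "c = (p, t1) - e0 *\<^sub>R (One :: ((real ^ 'n) \<times> real) \<times> real)"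
  define d where "d = (q, t2) + e0 *\<^sub>R (One :: ((real ^ 'n) \<times> real) \<times> real)"
  have bt: "((0, 1) :: ((real ^ 'n) \<times> real) \<times> real) \<in> Basis"
    and bi: "\<And>i. i \<in> Basis \<Longrightarrow> ((i, 0) :: ((real ^ 'n) \<times> real) \<times> real) \<in> Basis"
    and bh: "(((0, 1), 0) :: ((real ^ 'n) \<times> real) \<times> real) \<in> Basis"
    by (auto simp: Basis_prod_def)
  have one: "One \<bullet> b = 1" if "b \<in> Basis" for b :: "((real ^ 'n) \<times> real) \<times> real"
    using inner_sum_left_Basis[OF that, of "\<lambda>_. 1"] by simp
  have box: "height z \<ge> \<delta> / 2" "z \<in> ?H" if "z \<in> cbox c d" for z
  proof -
    have "c \<bullet> ((0, 1), 0) \<le> z \<bullet> ((0, 1), 0)" "c \<bullet> (0, 1) \<le> z \<bullet> (0, 1)" "z \<bullet> (0, 1) \<le> d \<bullet> (0, 1)"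
      using that bt bh unfolding mem_box by blast+
    then have *: "snd p - e0 \<le> height z" "t1 - e0 \<le> snd z" "snd z \<le> t2 + e0"
      by (simp_all add: c_def d_def inner_diff_left inner_add_left one[OF bh] one[OF bt])
         (simp_all add: inner_prod_def)
    then show "height z \<ge> \<delta> / 2" using e0 \<delta> by linarith
    then have "height z > 0" using \<delta> by linarith
    moreover have "0 < snd z" using *(2) e0(1,3) t by linarith
    moreover have "snd z < T" using *(3) e0(4) t(3) by (simp add: field_simps)
    ultimately show "z \<in> ?H" by (cases z) (auto simp: half_space_def)
  qed
  have ball: "cball (X, t) e \<subseteq> cbox c d"
    if "X \<in> cbox p q" "t1 \<le> t" "t \<le> t2" "e \<le> e0" for X t e
  proof
    fix z assume z: "z \<in> cball (X, t) e"
    have in0: "(X, t) \<in> cbox (p, t1) (q, t2)" using that by (simp flip: cbox_prod add: cbox_interval cbox_Pair_iff)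
    show "z \<in> cbox c d"
      unfolding mem_box
    proof (intro ballI)
      fix i :: "((real ^ 'n) \<times> real) \<times> real" assume i: "i \<in> Basis"
      have "\<bar>(z - (X, t)) \<bullet> i\<bar> \<le> e0"
        using Basis_le_norm[OF i, of "z - (X, t)"] z that(4) by (simp add: dist_norm norm_minus_commute)
      moreover have "(p, t1) \<bullet> i \<le> (X, t) \<bullet> i" "(X, t) \<bullet> i \<le> (q, t2) \<bullet> i"
        using in0 i unfolding mem_box by blast+
      ultimately show "c \<bullet> i \<le> z \<bullet> i \<and> z \<bullet> i \<le> d \<bullet> i"
        by (simp add: c_def d_def inner_diff_left inner_add_left one[OF i] abs_le_iff)
    qed
  qed
  have WH: "continuous_on ?H W"
    unfolding W_def by (intro continuous_intros cont) (auto simp: half_space_def)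
  have Wc: "continuous_on (cbox c d) W"
    by (rule continuous_on_subset[OF WH]) (use box in blast)
  have WA: "\<bar>W z\<bar> \<le> A" if "z \<in> cbox c d" for z
  proof -
    have "height z powr (a / 2) \<le> (\<delta> / 2) powr (a / 2)"
      by (rule powr_mono2') (use box(1)[OF that] a \<delta> in auto)
    then show ?thesis
      unfolding W_def A abs_mult using bounded[OF box(2)[OF that]] by (intro mult_mono) auto
  qed
  have "(X0, t1) \<in> cbox c d" using ball[OF X0 order_refl t(2), of 0] e0 by simp
  from WA[OF this] have A0: "A \<ge> 0" by linarith
  have g: "\<bar>W z * (?k / (height z)\<^sup>2)\<bar> \<le> B" if "z \<in> cbox c d" for z
  proof -
    have "(\<delta> / 2)\<^sup>2 \<le> (height z)\<^sup>2" using box(1)[OF that] \<delta> by (intro power_mono) auto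
    then have "\<bar>?k\<bar> / (height z)\<^sup>2 \<le> \<bar>?k\<bar> / (\<delta> / 2)\<^sup>2"
      using \<delta> box(1)[OF that] by (intro divide_left_mono mult_pos_pos zero_less_power) auto
    then have "\<bar>W z\<bar> * (\<bar>?k\<bar> / (height z)\<^sup>2) \<le> A * (\<bar>?k\<bar> / (\<delta> / 2)\<^sup>2)"
      by (intro mult_mono WA[OF that] A0) auto
    then show ?thesis unfolding B by (simp add: abs_mult mult_ac)
  qed
  define L where "L = (2 * real DIM((real ^ 'n) \<times> real) * A\<^sup>2 * K\<^sup>2 + 2 * A * B * K\<^sup>2)
          * measure lborel (cbox p q) * (t2 - t1)"
  have \<phi>c: "continuous_on S \<phi>" for S
    using has_partial_continuous(1)[OF \<phi>] nonempty_Basis by blast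
  have approx: "\<exists>w. continuous_on UNIV w \<and>
      (\<forall>X\<in>cbox p q. \<forall>t\<in>{t1..t2}. \<bar>w (X, t) - W (X, t)\<bar> \<le> \<epsilon> \<and> \<bar>w (X, t)\<bar> \<le> A) \<and>
      integral (cbox p q) (\<lambda>X. (w (X, t2))\<^sup>2 * (\<phi> X)\<^sup>2)
        \<ge> integral (cbox p q) (\<lambda>X. (w (X, t1))\<^sup>2 * (\<phi> X)\<^sup>2) - L"
    if \<epsilon>: "\<epsilon> > 0" for \<epsilon>
  proof -
    have "uniformly_continuous_on (cbox c d) W"
      by (rule compact_uniformly_continuous[OF Wc compact_cbox])
    then obtain e1 where e1: "e1 > 0"
      "\<And>z y. z \<in> cbox c d \<Longrightarrow> y \<in> cbox c d \<Longrightarrow> dist z y < e1 \<Longrightarrow> dist (W z) (W y) < \<epsilon>"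
      unfolding uniformly_continuous_on_def using \<epsilon> by meson
    define e where "e = min e0 (e1 / 2)"
    have e: "0 < e" "e \<le> e0" "e < e1" using e0(1) e1(1) by (auto simp: e_def)
    obtain \<eta> :: "((real ^ 'n) \<times> real) \<times> real \<Rightarrow> real" where \<eta>: "mollifier e \<eta>"
      using mollifier_exists[OF e(1)] .
    have \<eta>k: "C_k k \<eta>" for k using \<eta> unfolding mollifier_def by blast
    let ?D = "\<lambda>v z. frechet_derivative \<eta> (at z) v"
    let ?DD = "\<lambda>v z. frechet_derivative (?D v) (at z) v"
    define conv where "conv \<theta> y = integral (cbox c d) (\<lambda>z. W z * \<theta> (z - y))"
      for \<theta> and y :: "((real ^ 'n) \<times> real) \<times> real"
    have \<eta>D: "has_partial v \<eta> (?D v)" "has_partial v (?D v) (?DD v)" if "v \<in> Basis" for v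
      using C_k_has_partial[OF \<eta>k that] C_k_has_partial[of 0 "?D v" v] \<eta>k[of "Suc (Suc (Suc 0))"] that
      by auto
    have w1: "has_partial v (conv \<eta>) (\<lambda>y. - conv (?D v) y)" if "v \<in> Basis" for v
      using convolution_has_partial[OF Wc \<eta>D(1)[OF that]] unfolding conv_def[abs_def] .
    have w2: "has_partial v (\<lambda>y. - conv (?D v) y) (\<lambda>y. conv (?DD v) y)" if "v \<in> Basis" for v
      using has_partial_mult[OF convolution_has_partial[OF Wc \<eta>D(2)[OF that]], of "\<lambda>z. -1" "\<lambda>z. 0"]
      unfolding conv_def[abs_def] by (simp add: has_partial_def)
    have ceta: "continuous_on S (\<lambda>z. f (z - y))" if "continuous_on UNIV f"
      for f :: "((real ^ 'n) \<times> real) \<times> real \<Rightarrow> real" and y S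
      by (rule continuous_on_compose2[OF that]) (auto intro!: continuous_intros)
    \<comment> \<open>The minus sign in front of the time derivative is that of \<open>\<partial>\<^sub>y \<eta> (z - y)\<close>; it disappears in
      the second derivatives. The test function is \<open>\<eta> (z - y)\<close> as a function of \<open>z\<close>.\<close>
    have pde: "- conv (?D (0, 1)) y + (\<Sum>i\<in>Basis. conv (?DD (i, 0)) y)
        = integral (cbox c d) (\<lambda>z. (W z * (?k / (height z)\<^sup>2)) * \<eta> (z - y))"
      if y: "cball y e \<subseteq> cbox c d" for y
    proof -
      define \<theta> where "\<theta> = (\<lambda>z. \<eta> (z - y))"
      have \<theta>0: "\<theta> z = 0" if "z \<notin> cball y e" for z
        unfolding \<theta>_def by (rule mollifier_eq_0[OF \<eta> that])
      have test: "test_function ?H \<theta>"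
        unfolding test_function_def
        using \<theta>0 y box(2) C_k_shift[OF \<eta>k] by (auto simp: \<theta>_def intro!: exI[of _ "cball y e"])
      have shift: "frechet_derivative (\<lambda>z. f (z - y)) (at z) v = frechet_derivative f (at (z - y)) v"
        if "C_k (Suc 0) f" for f v z
      proof -
        have "((\<lambda>z. z - y) has_derivative (\<lambda>v. v)) (at z)" by (auto intro!: derivative_eq_intros)
        from has_derivative_compose[OF this C_k_has_derivative[OF that]]
        have "frechet_derivative f (at (z - y)) = frechet_derivative (\<lambda>z. f (z - y)) (at z)"
          by (rule frechet_derivative_at)
        then show ?thesis by simp
      qed
      have D\<theta>: "frechet_derivative \<theta> (at z) v = ?D v (z - y)" for z v
        unfolding \<theta>_def by (rule shift[OF \<eta>k])
      have DD\<theta>: "frechet_derivative (\<lambda>z. frechet_derivative \<theta> (at z) v) (at z) v = ?DD v (z - y)"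
        if "v \<in> Basis" for z v
        unfolding D\<theta> by (rule shift) (use \<eta>k[of "Suc (Suc 0)"] that in auto)
      define h where "h z = W z * (frechet_derivative \<theta> (at z) (0, 1)
        - (\<Sum>i\<in>Basis. frechet_derivative (\<lambda>z. frechet_derivative \<theta> (at z) (i, 0)) (at z) (i, 0))
        + ?k * \<theta> z / (height z)\<^sup>2)" for z
      have zero: "(LINT z:?H|lborel. h z) = 0"
        using weak_solution_distributional[OF weak cont test] unfolding h_def W_def by simp
      have h0: "h z = 0" if "z \<notin> cball y e" for z
      proof -
        have d0: "frechet_derivative f (at z) v = 0" if "\<And>z. z \<notin> cball y e \<Longrightarrow> f z = 0"
          "z \<notin> cball y e" for f v z
          using frechet_derivative_at[OF frechet_derivative_zero_off_support[of "cball y e" f z]] that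
          by (metis closed_cball)
        have d1: "frechet_derivative \<theta> (at z) v = 0" if "z \<notin> cball y e" for z v
          using d0 \<theta>0 that by blast
        have "frechet_derivative (\<lambda>z. frechet_derivative \<theta> (at z) v) (at z) v = 0" for v
          by (rule d0[OF d1 that])
        then show ?thesis using \<theta>0[OF that] d1[OF that] unfolding h_def by simp
      qed
      have hc: "continuous_on (cbox c d) (\<lambda>z. W z * ?D (0, 1) (z - y))"
          "continuous_on (cbox c d) (\<lambda>z. W z * ?DD (i, 0) (z - y))"
          "continuous_on (cbox c d) (\<lambda>z. (W z * (?k / (height z)\<^sup>2)) * \<eta> (z - y))"
        if "i \<in> Basis" for i
        using box \<delta> that
        by (auto intro!: continuous_intros Wc ceta has_partial_continuous(1)[OF \<eta>D(1)[OF bt]]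
          has_partial_continuous(2)[OF \<eta>D(1)[OF bt]] has_partial_continuous(2)[OF \<eta>D(2)[OF bi]]) fastforce+
      obtain i0 where "i0 \<in> (Basis :: ((real ^ 'n) \<times> real) set)" using nonempty_Basis by blast
      note hc = hc(1)[OF this] hc(2) hc(3)[OF this]
      have h_eq: "h z = W z * ?D (0, 1) (z - y) - (\<Sum>i\<in>Basis. W z * ?DD (i, 0) (z - y))
          + (W z * (?k / (height z)\<^sup>2)) * \<eta> (z - y)" for z
      proof -
        have "(\<Sum>i\<in>Basis. frechet_derivative (\<lambda>z. frechet_derivative \<theta> (at z) (i, 0)) (at z) (i, 0))
            = (\<Sum>i\<in>Basis. ?DD (i, 0) (z - y))"
          by (intro sum.cong refl DD\<theta> bi)
        then show ?thesis
          unfolding h_def by (simp add: D\<theta> sum_distrib_left[symmetric] algebra_simps) (simp add: \<theta>_def)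
      qed
      have inth: "(h has_integral (conv (?D (0, 1)) y - (\<Sum>i\<in>Basis. conv (?DD (i, 0)) y)
          + integral (cbox c d) (\<lambda>z. (W z * (?k / (height z)\<^sup>2)) * \<eta> (z - y)))) (cbox c d)"
        unfolding h_eq[abs_def] conv_def
        by (intro has_integral_add has_integral_diff has_integral_sum finite_Basis
            integrable_integral integrable_continuous hc)
      have "set_integrable lborel (cbox c d) h"
        unfolding set_integrable_def h_eq[abs_def]
        by (intro borel_integrable_compact compact_cbox continuous_intros hc)
      then have "(LINT z:cbox c d|lborel. h z) = integral (cbox c d) h"
        by (rule set_borel_integral_eq_integral)
      moreover have "(LINT z:cbox c d|lborel. h z) = (LINT z:?H|lborel. h z)"
        unfolding set_lebesgue_integral_def
      proof (intro Bochner_Integration.integral_cong refl)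
        fix z
        show "indicator (cbox c d) z *\<^sub>R h z = indicator ?H z *\<^sub>R h z"
          using h0[of z] y box(2)[of z] by (cases "z \<in> cball y e") (auto simp: indicator_def simp del: mem_cball)
      qed
      ultimately have "integral (cbox c d) h = 0" using zero by simp
      then show ?thesis using integral_unique[OF inth] by simp
    qed
    have sub: "cball (X, t) e \<subseteq> cbox c d" if "X \<in> cbox p q" "t1 \<le> t" "t \<le> t2" for X t
      using ball[OF that e(2)] .
    have wA: "\<bar>conv \<eta> (X, t)\<bar> \<le> A" if "X \<in> cbox p q" "t1 \<le> t" "t \<le> t2" for X t
      unfolding conv_def
      by (rule mollifier_average_bound[OF \<eta> Wc sub[OF that]]) (use WA sub[OF that] in blast)
    have gB: "\<bar>- conv (?D (0, 1)) (X, t) + (\<Sum>i\<in>Basis. conv (?DD (i, 0)) (X, t))\<bar> \<le> B"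
      if "X \<in> cbox p q" "t1 \<le> t" "t \<le> t2" for X t
      unfolding pde[OF sub[OF that]]
    proof (rule mollifier_average_bound[OF \<eta> _ sub[OF that]])
      show "continuous_on (cbox c d) (\<lambda>z. W z * (?k / (height z)\<^sup>2))"
        using box(1) \<delta> by (intro continuous_intros Wc) fastforce
    qed (use g sub[OF that] in blast)
    \<comment> \<open>\<open>\<eta>\<close> has integral \<open>1\<close>, so the difference is the average of \<open>W z - W (X, t)\<close>.\<close>
    have wW: "\<bar>conv \<eta> (X, t) - W (X, t)\<bar> \<le> \<epsilon>" if "X \<in> cbox p q" "t1 \<le> t" "t \<le> t2" for X t
    proof -
      note s = sub[OF that]
      have "(X, t) \<in> cbox c d" using s e(1) by auto
      have \<eta>1: "((\<lambda>z. \<eta> (z - (X, t))) has_integral 1) (cbox c d)"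
        using \<eta> s unfolding mollifier_def by blast
      have "(\<lambda>z. W z * \<eta> (z - (X, t))) integrable_on cbox c d"
        by (intro integrable_continuous continuous_intros Wc ceta C_k_continuous[OF \<eta>k])
      then have "((\<lambda>z. W z * \<eta> (z - (X, t)) - W (X, t) * \<eta> (z - (X, t))) has_integral
          (conv \<eta> (X, t) - W (X, t) * 1)) (cbox c d)"
        unfolding conv_def by (intro has_integral_diff has_integral_mult_right \<eta>1 integrable_integral)
      then have "conv \<eta> (X, t) - W (X, t) = integral (cbox c d) (\<lambda>z. (W z - W (X, t)) * \<eta> (z - (X, t)))"
        by (simp add: left_diff_distrib integral_unique)
      also have "\<bar>\<dots>\<bar> \<le> \<epsilon>"
      proof (rule mollifier_average_bound[OF \<eta> _ s])
        show "continuous_on (cbox c d) (\<lambda>z. W z - W (X, t))" by (intro continuous_intros Wc)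
        fix z assume "z \<in> cball (X, t) e"
        then show "\<bar>W z - W (X, t)\<bar> \<le> \<epsilon>"
          using e1(2)[of z "(X, t)"] s \<open>(X, t) \<in> cbox c d\<close> e(3)
          by (auto simp: dist_real_def dist_commute)
      qed
      finally show ?thesis .
    qed
    have "integral (cbox p q) (\<lambda>X. (conv \<eta> (X, t2))\<^sup>2 * (\<phi> X)\<^sup>2)
        \<ge> integral (cbox p q) (\<lambda>X. (conv \<eta> (X, t1))\<^sup>2 * (\<phi> X)\<^sup>2) - L"
      unfolding L_def
      by (rule energy_inequality[OF w1[OF bt] w1[OF bi] w2[OF bi] \<phi> supp wA gB \<phi>K \<phi>iK t(2)])
    then show ?thesis
      using wA wW has_partial_continuous(1)[OF w1[OF bt], of UNIV]
      by (intro exI[of _ "conv \<eta>"]) auto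
  qed
  let ?J = "\<lambda>w t. integral (cbox p q) (\<lambda>X. (w (X, t))\<^sup>2 * (\<phi> X)\<^sup>2)"
  have near: "\<bar>?J w t - ?J W t\<bar> \<le> \<epsilon> * (2 * A * K\<^sup>2 * measure lborel (cbox p q))"
    if w: "continuous_on UNIV w"
      and wW: "\<And>X. X \<in> cbox p q \<Longrightarrow> \<bar>w (X, t) - W (X, t)\<bar> \<le> \<epsilon> \<and> \<bar>w (X, t)\<bar> \<le> A"
      and tt: "t1 \<le> t" "t \<le> t2" for w t \<epsilon>
  proof -
    have c1: "continuous_on (cbox p q) (\<lambda>X. w (X, t))"
      by (rule continuous_on_compose2[OF w]) (auto intro!: continuous_intros)
    have inbox: "(X, t) \<in> cbox c d" if "X \<in> cbox p q" for X
      using ball[OF that tt, of 0] e0 by simp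
    have c2: "continuous_on (cbox p q) (\<lambda>X. W (X, t))"
      by (rule continuous_on_compose2[OF Wc]) (auto intro!: continuous_intros inbox)
    have i: "(\<lambda>X. (w (X, t))\<^sup>2 * (\<phi> X)\<^sup>2) integrable_on cbox p q"
      "(\<lambda>X. (W (X, t))\<^sup>2 * (\<phi> X)\<^sup>2) integrable_on cbox p q"
      by (intro integrable_continuous continuous_intros c1 c2 \<phi>c)+
    have "?J w t - ?J W t = integral (cbox p q) (\<lambda>X. (w (X, t))\<^sup>2 * (\<phi> X)\<^sup>2 - (W (X, t))\<^sup>2 * (\<phi> X)\<^sup>2)"
      by (rule integral_diff[OF i, symmetric])
    also have "norm \<dots> \<le> integral (cbox p q) (\<lambda>X. \<epsilon> * (2 * A * K\<^sup>2))"
    proof (rule integral_norm_bound_integral)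
      show "(\<lambda>X. (w (X, t))\<^sup>2 * (\<phi> X)\<^sup>2 - (W (X, t))\<^sup>2 * (\<phi> X)\<^sup>2) integrable_on cbox p q"
        by (intro integrable_diff i)
      fix X assume X: "X \<in> cbox p q"
      have "\<bar>w (X, t) + W (X, t)\<bar> \<le> 2 * A" using wW[OF X] WA[OF inbox[OF X]] by linarith
      moreover have "\<bar>\<phi> X\<bar>\<^sup>2 \<le> K\<^sup>2" using \<phi>K[OF X] by (intro power_mono) auto
      ultimately have "\<bar>w (X, t) - W (X, t)\<bar> * (\<bar>w (X, t) + W (X, t)\<bar> * \<bar>\<phi> X\<bar>\<^sup>2) \<le> \<epsilon> * (2 * A * K\<^sup>2)"
        using wW[OF X] A0 by (intro mult_mono) auto
      moreover have "(w (X, t))\<^sup>2 * (\<phi> X)\<^sup>2 - (W (X, t))\<^sup>2 * (\<phi> X)\<^sup>2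
          = (w (X, t) - W (X, t)) * ((w (X, t) + W (X, t)) * (\<phi> X)\<^sup>2)"
        by (simp add: power2_eq_square algebra_simps)
      ultimately show "norm ((w (X, t))\<^sup>2 * (\<phi> X)\<^sup>2 - (W (X, t))\<^sup>2 * (\<phi> X)\<^sup>2) \<le> \<epsilon> * (2 * A * K\<^sup>2)"
        by (simp add: abs_mult)
    qed auto
    finally show ?thesis by (simp add: mult_ac)
  qed
  define N where "N = 2 * (2 * A * K\<^sup>2 * measure lborel (cbox p q))"
  have "?J W t1 - L \<le> ?J W t2 + \<epsilon>" if "\<epsilon> > 0" for \<epsilon>
  proof -
    have "N \<ge> 0" unfolding N_def using A0 by simp
    define \<epsilon>' where "\<epsilon>' = \<epsilon> / (N + 1)"
    have \<epsilon>': "\<epsilon>' > 0" "\<epsilon>' * N \<le> \<epsilon>" unfolding \<epsilon>'_def using that \<open>N \<ge> 0\<close> by (auto simp: field_simps)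
    obtain w where w: "continuous_on UNIV w"
      "\<And>X t. X \<in> cbox p q \<Longrightarrow> t1 \<le> t \<Longrightarrow> t \<le> t2 \<Longrightarrow> \<bar>w (X, t) - W (X, t)\<bar> \<le> \<epsilon>' \<and> \<bar>w (X, t)\<bar> \<le> A"
      "?J w t1 - L \<le> ?J w t2"
      using approx[OF \<epsilon>'(1)] by (meson atLeastAtMost_iff)
    have "\<bar>?J w t1 - ?J W t1\<bar> \<le> (\<epsilon>' * N) / 2" "\<bar>?J w t2 - ?J W t2\<bar> \<le> (\<epsilon>' * N) / 2"
      using near[OF w(1) w(2), of t1] near[OF w(1) w(2), of t2] t unfolding N_def by (auto simp: mult_ac)
    then show ?thesis using w(3) \<epsilon>'(2) by linarith
  qed
  then have "?J W t1 - L \<le> ?J W t2" by (rule field_le_epsilon)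
  then show ?thesis unfolding L_def .
qed

section \<open>Thin slabs, cutoffs and changes of variables\<close>

lemma open_half_ball: "open (half_ball P r)"
  unfolding half_ball_def by (intro open_Collect_conj open_Collect_less continuous_intros)

text \<open>
  Fubini: the volume of the base times \<open>\<integral>\<^bsub>0\<^esub>\<^bsup>h\<^esup> y\<^sup>a dy\<close>, which is finite and tends to \<open>0\<close> with \<open>h\<close>
  because \<open>a > -1\<close>.
\<close>

lemma powr_slab_integral:
  fixes x :: "real ^ 'n"
  assumes a: "a > -1" and l: "l \<ge> 0" and h: "h \<ge> 0"
  shows "integrable lborel (\<lambda>X. indicator (cbox x (x + l *\<^sub>R One) \<times> {0..h}) X * snd X powr a)"
    and "(LINT X|lborel. indicator (cbox x (x + l *\<^sub>R One) \<times> {0..h}) X * snd X powr a)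
      = l ^ CARD('n) * (h powr (a + 1) / (a + 1))"
proof -
  let ?C = "cbox x (x + l *\<^sub>R One)"
  let ?Z = "\<lambda>y. indicator {0..h} y * y powr a :: real"
  let ?f = "\<lambda>X. indicator (?C \<times> {0..h}) X * snd X powr a :: real"
  have Z: "integral\<^sup>N lborel ?Z = h powr (a + 1) / (a + 1)"
  proof (rule nn_integral_has_integral_lborel)
    have "((\<lambda>y. if y \<in> {0..h} then y powr a else 0) has_integral (h powr (a + 1) / (a + 1))) UNIV"
      unfolding has_integral_restrict_UNIV by (rule has_integral_powr_from_0[OF a h])
    then show "(?Z has_integral (h powr (a + 1) / (a + 1))) UNIV"
      by (rule has_integral_cong[THEN iffD1, rotated]) (auto simp: indicator_def)
  qed (auto simp: indicator_def)
  have meas: "?f \<in> borel_measurable borel"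
  proof -
    have "?C \<times> {0..h} \<in> sets borel" by (intro borel_closed closed_Times) auto
    moreover have "(\<lambda>X :: (real ^ 'n) \<times> real. snd X) \<in> borel_measurable borel"
      by (intro borel_measurable_continuous_onI continuous_intros)
    ultimately show ?thesis by (intro borel_measurable_times borel_measurable_indicator powr_real_measurable) auto
  qed
  have C: "emeasure lborel ?C = ennreal (l ^ CARD('n))"
  proof -
    have "emeasure lborel ?C \<noteq> top" using emeasure_lborel_cbox_finite[of x "x + l *\<^sub>R One"] by auto
    then have "emeasure lborel ?C = ennreal (measure lborel ?C)" by (rule emeasure_eq_ennreal_measure)
    then show ?thesis using content_cbox_plus[of x l] l by simp
  qed
  have "integral\<^sup>N lborel ?f = (\<integral>\<^sup>+ u. \<integral>\<^sup>+ y. ?f (u, y) \<partial>lborel \<partial>lborel)"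
    using lborel.nn_integral_fst[of "\<lambda>X. ennreal (?f X)" lborel] meas by (simp add: lborel_prod)
  also have "\<dots> = (\<integral>\<^sup>+ u. indicator ?C u * integral\<^sup>N lborel ?Z \<partial>lborel)"
  proof (intro nn_integral_cong)
    fix u
    have "(\<integral>\<^sup>+ y. ?f (u, y) \<partial>lborel) = (\<integral>\<^sup>+ y. indicator ?C u * ennreal (?Z y) \<partial>lborel)"
      by (intro nn_integral_cong) (auto simp: indicator_def)
    also have "\<dots> = indicator ?C u * integral\<^sup>N lborel ?Z"
      by (rule nn_integral_cmult) auto
    finally show "(\<integral>\<^sup>+ y. ?f (u, y) \<partial>lborel) = indicator ?C u * integral\<^sup>N lborel ?Z" .
  qed
  also have "\<dots> = emeasure lborel ?C * integral\<^sup>N lborel ?Z"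
    by (subst nn_integral_multc) auto
  also have "\<dots> = ennreal (l ^ CARD('n) * (h powr (a + 1) / (a + 1)))"
    unfolding Z C using a l h by (intro ennreal_mult[symmetric]) auto
  finally have nn: "integral\<^sup>N lborel ?f = ennreal (l ^ CARD('n) * (h powr (a + 1) / (a + 1)))" .
  show "integrable lborel ?f"
    by (rule integrableI_nn_integral_finite[OF _ _ nn]) (use meas in auto)
  show "integral\<^sup>L lborel ?f = l ^ CARD('n) * (h powr (a + 1) / (a + 1))"
    by (rule integral_eq_nn_integral[THEN trans]) (use meas nn a l h in auto)
qed

lemma has_partial_pos_part_squared:
  assumes "has_partial b f f'"
  shows "has_partial b (\<lambda>z. (max 0 (f z))\<^sup>2) (\<lambda>z. 2 * max 0 (f z) * f' z)"
proof -
  have pos: "((\<lambda>x::real. (max 0 x)\<^sup>2) has_real_derivative 2 * max 0 x) (at x)" for x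
  proof (cases x "0::real" rule: linorder_cases)
    case less
    have "((\<lambda>x::real. 0) has_real_derivative 0) (at x)" by simp
    then have "((\<lambda>x::real. (max 0 x)\<^sup>2) has_real_derivative 0) (at x)"
      by (rule has_field_derivative_transform_within_open[where S = "{..<0}"]) (use less in auto)
    then show ?thesis using less by simp
  next
    case equal
    have "((\<lambda>y::real. max 0 y) \<longlongrightarrow> max 0 0) (at 0)" by (intro tendsto_intros)
    moreover have "(\<lambda>y::real. ((max 0 y)\<^sup>2 - (max 0 0)\<^sup>2) / (y - 0)) = (\<lambda>y. max 0 y)"
      by (auto simp: fun_eq_iff max_def power2_eq_square)
    ultimately show ?thesis unfolding equal has_field_derivative_iff by simp
  next
    case greater
    have "((\<lambda>x::real. x\<^sup>2) has_real_derivative 2 * x) (at x)"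
      by (auto intro!: derivative_eq_intros)
    then have "((\<lambda>x::real. (max 0 x)\<^sup>2) has_real_derivative 2 * x) (at x)"
      by (rule has_field_derivative_transform_within_open[where S = "{0<..}"]) (use greater in auto)
    then show ?thesis using greater by simp
  qed
  have "((\<lambda>h. (max 0 (f (z + h *\<^sub>R b)))\<^sup>2) has_real_derivative 2 * max 0 (f (z + 0 *\<^sub>R b)) * f' (z + 0 *\<^sub>R b)) (at 0)" for z
    by (rule DERIV_chain2[OF pos has_partial_at[OF assms]])
  then show ?thesis
    using assms unfolding has_partial_def by (auto intro!: continuous_intros continuous_on_max)
qed

text \<open>
  The energy inequality needs only continuous first derivatives, so truncated polynomials do. The
  cutoff is supported in the half-ball of radius \<open>2 r\<close> and above height \<open>\<delta>\<close>; it is not normalized to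
  \<open>1\<close> on the smaller half-ball, where a positive lower bound suffices.
\<close>

definition cutoff :: "real ^ 'n \<Rightarrow> real \<Rightarrow> real \<Rightarrow> (real ^ 'n) \<times> real \<Rightarrow> real" where
  "cutoff P r \<delta> X = (max 0 (4 * r\<^sup>2 - (norm (X - (P, 0)))\<^sup>2))\<^sup>2 * (max 0 (snd X - \<delta>))\<^sup>2"

definition cutoff_partial ::
    "real ^ 'n \<Rightarrow> real \<Rightarrow> real \<Rightarrow> (real ^ 'n) \<times> real \<Rightarrow> (real ^ 'n) \<times> real \<Rightarrow> real" where
  "cutoff_partial P r \<delta> i X =
     (max 0 (4 * r\<^sup>2 - (norm (X - (P, 0)))\<^sup>2))\<^sup>2 * (2 * max 0 (snd X - \<delta>) * snd i)
     + 2 * max 0 (4 * r\<^sup>2 - (norm (X - (P, 0)))\<^sup>2) * (- 2 * ((X - (P, 0)) \<bullet> i)) * (max 0 (snd X - \<delta>))\<^sup>2"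

lemma has_partial_cutoff:
  fixes i :: "(real ^ 'n) \<times> real"
  shows "has_partial i (cutoff P r \<delta>) (cutoff_partial P r \<delta> i)"
proof -
  have "has_partial i (\<lambda>X. 4 * r\<^sup>2 - (norm (X - (P, 0)))\<^sup>2) (\<lambda>X. - 2 * ((X - (P, 0)) \<bullet> i))"
    unfolding has_partial_def power2_norm_eq_inner
  proof (intro conjI allI continuous_intros)
    fix X :: "(real ^ 'n) \<times> real"
    show "((\<lambda>h. 4 * r\<^sup>2 - (X + h *\<^sub>R i - (P, 0)) \<bullet> (X + h *\<^sub>R i - (P, 0))) has_real_derivative
      - 2 * ((X - (P, 0)) \<bullet> i)) (at 0)"
      unfolding has_field_derivative_def
      by (auto intro!: derivative_eq_intros simp: inner_commute algebra_simps)
  qed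
  moreover have "has_partial i (\<lambda>X. snd X - \<delta>) (\<lambda>X. snd i)"
    unfolding has_partial_def by (auto intro!: continuous_intros derivative_eq_intros)
  ultimately show ?thesis
    unfolding cutoff_def[abs_def] cutoff_partial_def[abs_def]
    by (intro has_partial_mult has_partial_pos_part_squared)
qed

lemma cutoff_eq_0:
  assumes "r > 0" "\<delta> > 0" and "X \<notin> half_ball P (2 * r) \<or> snd X \<le> \<delta>"
  shows "cutoff P r \<delta> X = 0" "cutoff_partial P r \<delta> i X = 0"
proof -
  have "4 * r\<^sup>2 - (norm (X - (P, 0)))\<^sup>2 \<le> 0 \<or> snd X - \<delta> \<le> 0"
  proof (cases "snd X \<le> \<delta>")
    case False
    then have "2 * r \<le> norm (X - (P, 0))"
      using assms unfolding half_ball_def by (auto simp: dist_norm)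
    then have "(2 * r)\<^sup>2 \<le> (norm (X - (P, 0)))\<^sup>2" using assms by (intro power_mono) auto
    then show ?thesis by (simp add: power_mult_distrib)
  qed simp
  then show "cutoff P r \<delta> X = 0" "cutoff_partial P r \<delta> i X = 0"
    unfolding cutoff_def cutoff_partial_def by auto
qed

lemma diff_Pair_0: "X - (P, 0) = (fst X - P, snd X)" for X :: "'a::real_vector \<times> real"
  by (simp add: prod_eq_iff)

text \<open>
  For \<open>r \<le> 2\<close> the factors on the support satisfy \<open>4 r\<^sup>2 - \<bar>X - P\<bar>\<^sup>2 \<le> 16\<close> and \<open>y - \<delta> \<le> 4\<close>, which bounds
  the function by \<open>16\<^sup>2 4\<^sup>2 = 4096\<close> and a partial derivative by \<open>2048 + 4096 = 6144\<close>, independently of \<open>P\<close>,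
  \<open>r\<close> and \<open>\<delta>\<close>.
\<close>

lemma cutoff_bounds:
  assumes r: "0 < r" "r \<le> 2" and \<delta>: "\<delta> > 0" and i: "i \<in> Basis"
  shows "\<bar>cutoff P r \<delta> X\<bar> \<le> 6144" "\<bar>cutoff_partial P r \<delta> i X\<bar> \<le> 6144"
proof -
  have "\<bar>cutoff P r \<delta> X\<bar> \<le> 6144 \<and> \<bar>cutoff_partial P r \<delta> i X\<bar> \<le> 6144"
  proof (cases "X \<notin> half_ball P (2 * r) \<or> snd X \<le> \<delta>")
    case True
    from cutoff_eq_0[OF r(1) \<delta> this] show ?thesis by simp
  next
    case False
    let ?Y = "X - (P, 0)"
    define A where "A = max 0 (4 * r\<^sup>2 - (norm ?Y)\<^sup>2)"
    define B where "B = max 0 (snd X - \<delta>)"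
    have n4: "norm ?Y \<le> 4" using False r unfolding half_ball_def by (auto simp: dist_norm)
    have "r\<^sup>2 \<le> 2\<^sup>2" using r by (intro power_mono) auto
    then have "r\<^sup>2 \<le> 4" by simp
    then have "4 * r\<^sup>2 - (norm ?Y)\<^sup>2 \<le> 16" using zero_le_power2[of "norm ?Y"] by linarith
    then have "0 \<le> A" "A \<le> 16" unfolding A_def by simp_all
    moreover have "\<bar>snd X\<bar> \<le> 4"
      using norm_snd_le[of "snd X" "fst X - P"] n4 unfolding diff_Pair_0 by simp
    then have "0 \<le> B" "B \<le> 4" unfolding B_def using \<delta> by auto
    moreover have Yi: "\<bar>?Y \<bullet> i\<bar> \<le> 4" using Basis_le_norm[OF i, of ?Y] n4 by linarith
    moreover have "\<bar>snd i\<bar> \<le> 1" using norm_snd_le[of "snd i" "fst i"] norm_Basis[OF i] by simp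
    ultimately have "A\<^sup>2 \<le> 16\<^sup>2" "B\<^sup>2 \<le> 4\<^sup>2" by (blast intro: power_mono)+
    have "\<bar>A\<^sup>2 * B\<^sup>2\<bar> \<le> 16\<^sup>2 * 4\<^sup>2"
      unfolding abs_mult using \<open>A\<^sup>2 \<le> 16\<^sup>2\<close> \<open>B\<^sup>2 \<le> 4\<^sup>2\<close> by (intro mult_mono) auto
    then have 1: "\<bar>A\<^sup>2 * B\<^sup>2\<bar> \<le> 4096" by (rule order_trans) simp
    have "\<bar>A\<^sup>2 * (2 * B * snd i)\<bar> \<le> 16\<^sup>2 * (2 * 4 * 1)"
      unfolding abs_mult using \<open>A\<^sup>2 \<le> 16\<^sup>2\<close> \<open>0 \<le> B\<close> \<open>B \<le> 4\<close> \<open>\<bar>snd i\<bar> \<le> 1\<close>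
      by (intro mult_mono) auto
    then have 2: "\<bar>A\<^sup>2 * (2 * B * snd i)\<bar> \<le> 2048" by (rule order_trans) simp
    have "\<bar>2 * A * (- 2 * (?Y \<bullet> i)) * B\<^sup>2\<bar> \<le> 2 * 16 * (2 * 4) * 4\<^sup>2"
      unfolding abs_mult using \<open>B\<^sup>2 \<le> 4\<^sup>2\<close> \<open>0 \<le> A\<close> \<open>A \<le> 16\<close> Yi
      by (intro mult_mono) auto
    then have 3: "\<bar>2 * A * (- 2 * (?Y \<bullet> i)) * B\<^sup>2\<bar> \<le> 4096" by (rule order_trans) simp
    have "\<bar>A\<^sup>2 * (2 * B * snd i) + 2 * A * (- 2 * (?Y \<bullet> i)) * B\<^sup>2\<bar> \<le> 6144"
      by (rule order_trans[OF abs_triangle_ineq]) (use 2 3 in linarith)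
    moreover have "\<bar>A\<^sup>2 * B\<^sup>2\<bar> \<le> 6144" using 1 by linarith
    ultimately show ?thesis
      unfolding cutoff_def cutoff_partial_def A_def[symmetric] B_def[symmetric] by blast
  qed
  then show "\<bar>cutoff P r \<delta> X\<bar> \<le> 6144" "\<bar>cutoff_partial P r \<delta> i X\<bar> \<le> 6144" by auto
qed

text \<open>
  On this set \<open>4 r\<^sup>2 - \<bar>X - P\<bar>\<^sup>2 \<ge> 3 r\<^sup>2 \<ge> 12 \<delta>\<^sup>2\<close> and \<open>y - \<delta> \<ge> \<delta>\<close>.
\<close>

lemma cutoff_lower_bound:
  assumes "0 < \<delta>" "2 * \<delta> \<le> r" and X: "X \<in> half_ball P r" "2 * \<delta> \<le> snd X"
  shows "(12 * \<delta>\<^sup>2) ^ 4 * \<delta> ^ 4 \<le> (cutoff P r \<delta> X)\<^sup>2"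
proof -
  have "(norm (X - (P, 0)))\<^sup>2 \<le> r\<^sup>2"
    using X(1) unfolding half_ball_def by (intro power_mono) (auto simp: dist_norm)
  moreover have "(2 * \<delta>)\<^sup>2 \<le> r\<^sup>2" using assms by (intro power_mono) auto
  ultimately have "12 * \<delta>\<^sup>2 \<le> 4 * r\<^sup>2 - (norm (X - (P, 0)))\<^sup>2" by (simp add: power_mult_distrib)
  then have A: "12 * \<delta>\<^sup>2 \<le> max 0 (4 * r\<^sup>2 - (norm (X - (P, 0)))\<^sup>2)" by simp
  have B: "\<delta> \<le> max 0 (snd X - \<delta>)" using X(2) by simp
  have "(12 * \<delta>\<^sup>2) ^ 4 * \<delta> ^ 4
    \<le> (max 0 (4 * r\<^sup>2 - (norm (X - (P, 0)))\<^sup>2)) ^ 4 * (max 0 (snd X - \<delta>)) ^ 4"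
    using assms A B by (intro mult_mono power_mono) auto
  also have "\<dots> = (cutoff P r \<delta> X)\<^sup>2"
    unfolding cutoff_def by (simp add: power_mult_distrib flip: power_mult)
  finally show ?thesis .
qed

lemma half_ball_subset_cbox:
  "X \<in> half_ball P r \<Longrightarrow> fst X \<in> cbox (P - r *\<^sub>R One) (P - r *\<^sub>R One + (2 * r) *\<^sub>R One) \<and> 0 < snd X \<and> snd X < r"
proof -
  assume "X \<in> half_ball P r"
  then have n: "norm (X - (P, 0)) < r" "snd X > 0" by (auto simp: half_ball_def dist_norm)
  have "\<bar>(fst X - P) \<bullet> i\<bar> \<le> r" if "i \<in> Basis" for i
    using Basis_le_norm[OF that, of "fst X - P"] norm_fst_le[of "fst X - P" "snd X"] n unfolding diff_Pair_0 by linarith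
  then have "fst X \<in> cbox (P - r *\<^sub>R One) (P - r *\<^sub>R One + (2 * r) *\<^sub>R One)"
    by (force simp: mem_box inner_diff_left inner_add_left abs_le_iff)
  moreover have "snd X < r" using norm_snd_le[of "snd X" "fst X - P"] n unfolding diff_Pair_0 by simp
  ultimately show ?thesis using n by simp
qed

lemma lborel_integral_affine:
  fixes g :: "'e::euclidean_space \<Rightarrow> real"
  assumes "g \<in> borel_measurable borel" and "R \<noteq> 0"
  shows "(LINT x|lborel. g x) = \<bar>R\<bar> ^ DIM('e) * (LINT x|lborel. g (t + R *\<^sub>R x))"
proof -
  have "(LINT x|lborel. g x)
      = (LINT x|density (distr lborel borel (\<lambda>x. t + R *\<^sub>R x)) (\<lambda>_. ennreal (\<bar>R\<bar> ^ DIM('e))). g x)"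
    using lborel_affine[OF assms(2), of t] by (simp add: ennreal_power)
  also have "\<dots> = (LINT x|distr lborel borel (\<lambda>x. t + R *\<^sub>R x). \<bar>R\<bar> ^ DIM('e) *\<^sub>R g x)"
    by (rule integral_density) (use assms in auto)
  also have "\<dots> = (LINT x|lborel. \<bar>R\<bar> ^ DIM('e) *\<^sub>R g (t + R *\<^sub>R x))"
    by (rule integral_distr) (use assms in measurable)
  finally show ?thesis by simp
qed

section \<open>Persistence of the local mass\<close>

text \<open>
  The half-ball lies in a cylinder over a cube of side \<open>2 r\<close>, and \<open>y\<^sup>a u\<^sup>2 \<le> C0\<^sup>2 y\<^sup>a\<close> there, so both bounds reduce to
  the integral of \<open>y\<^sup>a\<close> over slabs. Integrability ensures that the integrals in the final statement are
  not default values.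
\<close>

lemma weighted_square_integrable:
  fixes u :: "(real ^ 'n) \<times> real \<Rightarrow> real"
  assumes a: "a > -1" and r: "r > 0" and u: "continuous_on half_space u"
    and bounded: "\<And>X. X \<in> half_space \<Longrightarrow> \<bar>u X\<bar> \<le> C0"
  shows "set_integrable lborel (half_ball P r) (\<lambda>X. snd X powr a * (u X)\<^sup>2)"
    and "(\<lambda>X. indicator (half_ball P r) X * (snd X powr a * (u X)\<^sup>2)) \<in> borel_measurable borel"
    and "0 \<le> h \<Longrightarrow> h \<le> r \<Longrightarrow>
      (LINT X:half_ball P r \<inter> {X. snd X < h}|lborel. snd X powr a * (u X)\<^sup>2)
        \<le> C0\<^sup>2 * ((2 * r) ^ CARD('n) * (h powr (a + 1) / (a + 1)))"
proof -
  let ?F = "\<lambda>X. snd X powr a * (u X)\<^sup>2"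
  let ?S = "\<lambda>h. cbox (P - r *\<^sub>R One) (P - r *\<^sub>R One + (2 * r) *\<^sub>R One) \<times> {0..h}"
  have hb: "half_ball P r \<subseteq> half_space" by (auto simp: half_ball_def half_space_def)
  have F: "continuous_on (half_ball P r) ?F"
    by (intro continuous_intros continuous_on_subset[OF u hb]) (use hb in \<open>auto simp: half_space_def\<close>)
  have F_le: "?F X \<le> C0\<^sup>2 * snd X powr a" if "X \<in> half_ball P r" for X
  proof -
    have "\<bar>u X\<bar>\<^sup>2 \<le> C0\<^sup>2" using bounded[of X] hb that by (intro power_mono) auto
    then show ?thesis using mult_left_mono[of "(u X)\<^sup>2" "C0\<^sup>2" "snd X powr a"] by (simp add: mult.commute)
  qed
  show meas: "(\<lambda>X. indicator (half_ball P r) X * ?F X) \<in> borel_measurable borel"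
    using borel_measurable_continuous_on_indicator[OF borel_open[OF open_half_ball] F] by simp
  have slab: "integrable lborel (\<lambda>X. C0\<^sup>2 * (indicator (?S h) X * snd X powr a))"
    "(LINT X|lborel. C0\<^sup>2 * (indicator (?S h) X * snd X powr a))
        = C0\<^sup>2 * ((2 * r) ^ CARD('n) * (h powr (a + 1) / (a + 1)))" if "h \<ge> 0" for h
    using powr_slab_integral[OF a _ that, of "2 * r" "P - r *\<^sub>R One"] r by auto
  show int: "set_integrable lborel (half_ball P r) ?F"
    unfolding set_integrable_def
  proof (rule Bochner_Integration.integrable_bound[OF slab(1)[of r]])
    have "norm (indicator (half_ball P r) X *\<^sub>R ?F X) \<le> norm (C0\<^sup>2 * (indicator (?S r) X * snd X powr a))" for X
      using F_le[of X] half_ball_subset_cbox[of X P r] by (cases X) (auto simp: indicator_def)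
    then show "AE X in lborel. norm (indicator (half_ball P r) X *\<^sub>R ?F X)
        \<le> norm (C0\<^sup>2 * (indicator (?S r) X * snd X powr a))" by simp
  qed (use r meas in auto)
  show "(LINT X:half_ball P r \<inter> {X. snd X < h}|lborel. ?F X)
        \<le> C0\<^sup>2 * ((2 * r) ^ CARD('n) * (h powr (a + 1) / (a + 1)))" if "0 \<le> h" "h \<le> r"
    unfolding slab(2)[OF that(1), symmetric] set_lebesgue_integral_def
  proof (rule integral_mono)
    have "half_ball P r \<inter> {X. snd X < h} \<in> sets borel"
      by (intro sets.Int borel_open open_half_ball open_Collect_less continuous_intros)
    then have "set_integrable lborel (half_ball P r \<inter> {X. snd X < h}) ?F"
      by (intro set_integrable_subset[OF int]) auto
    then show "integrable lborel (\<lambda>X. indicator (half_ball P r \<inter> {X. snd X < h}) X *\<^sub>R ?F X)"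
      unfolding set_integrable_def .
    fix X
    show "indicator (half_ball P r \<inter> {X. snd X < h}) X *\<^sub>R ?F X
        \<le> C0\<^sup>2 * (indicator (?S h) X * snd X powr a)"
      using F_le[of X] half_ball_subset_cbox[of X P r] by (cases X) (auto simp: indicator_def)
  qed (rule slab(1)[OF that(1)])
qed

text \<open>
  The constants are fixed before the solution: \<open>h\<close> so small that the slab \<open>y < h\<close> of a half-ball of radius
  at most \<open>2\<close> carries mass at most \<open>\<kappa>/2\<close>, then the cutoff at height \<open>\<delta> = h/2\<close>, then \<open>c\<close> so small that the
  energy drops by at most half of its initial lower bound \<open>\<mu> \<kappa> / 2\<close>. The cutoff at time \<open>t\<close> is bounded by
  \<open>K\<close>, whence \<open>m = \<mu> \<kappa> / (4 K\<^sup>2)\<close>.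
\<close>

lemma local_mass_persistence:
  fixes a \<kappa> C0 :: real
  assumes a: "-1 < a" "a \<le> 0" and \<kappa>: "0 < \<kappa>"
  obtains m c :: real where "0 < m" "0 < c" "c < 1"
    "\<And>T V (U :: ((real ^ 'n) \<times> real) \<times> real \<Rightarrow> real) P r t0 t.
       weak_solution a T V U \<Longrightarrow> continuous_on (half_space \<times> {0..<T}) U \<Longrightarrow>
       (\<And>z. z \<in> half_space \<times> {0..<T} \<Longrightarrow> \<bar>U z\<bar> \<le> C0) \<Longrightarrow>
       0 < r \<Longrightarrow> r \<le> 2 \<Longrightarrow> 0 \<le> t0 \<Longrightarrow> t0 \<le> t \<Longrightarrow> t \<le> t0 + c \<Longrightarrow> t < T \<Longrightarrow>
       \<kappa> \<le> (LINT X:half_ball P r|lborel. snd X powr a * (U (X, t0))\<^sup>2) \<Longrightarrow>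
       m \<le> (LINT X:half_ball P (2 * r)|lborel. snd X powr a * (U (X, t))\<^sup>2)"
proof -
  \<comment> \<open>Solves \<open>C0\<^sup>2 4\<^sup>n h\<^bsup>a+1\<^esup> / (a + 1) = \<kappa> / 2\<close>, with \<open>C0\<^sup>2 + 1\<close> for \<open>C0\<^sup>2\<close> to avoid a zero denominator.\<close>
  define h where "h = (\<kappa> * (a + 1) / (2 * 4 ^ CARD('n) * (C0\<^sup>2 + 1))) powr (1 / (a + 1))"
  have nz: "C0\<^sup>2 + 1 > 0" by (simp add: add_nonneg_pos)
  have h: "h > 0" unfolding h_def using a \<kappa> nz by simp
  have thin: "C0\<^sup>2 * (4 ^ CARD('n) * (h powr (a + 1) / (a + 1))) \<le> \<kappa> / 2"
  proof -
    have "h powr (a + 1) = \<kappa> * (a + 1) / (2 * 4 ^ CARD('n) * (C0\<^sup>2 + 1))"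
      unfolding h_def powr_powr using a \<kappa> nz by simp
    moreover have "C * (F * (\<kappa> * b / (2 * F * D) / b)) = (\<kappa> / 2) * (C / D)"
      if "F > 0" "D > 0" "b > 0" for C F D b :: real
      using that by (simp add: field_simps)
    ultimately have "C0\<^sup>2 * (4 ^ CARD('n) * (h powr (a + 1) / (a + 1))) = (\<kappa> / 2) * (C0\<^sup>2 / (C0\<^sup>2 + 1))"
      using a nz by (simp only:) simp
    also have "\<dots> \<le> (\<kappa> / 2) * 1"
      using \<kappa> by (intro mult_left_mono) (auto simp: divide_simps add_nonneg_pos)
    finally show ?thesis by simp
  qed
  define \<delta> where "\<delta> = h / 2"
  have \<delta>: "\<delta> > 0" using h by (simp add: \<delta>_def)
  \<comment> \<open>The lower bound on the square of the cutoff over the part of the half-ball above \<open>h\<close>.\<close>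
  define \<mu> where "\<mu> = (12 * \<delta>\<^sup>2) ^ 4 * \<delta> ^ 4"
  have \<mu>: "\<mu> > 0" using \<delta> by (simp add: \<mu>_def)
  define K :: real where "K = 6144"
  define A where "A = (\<delta> / 2) powr (a / 2) * C0"
  define B where "B = \<bar>(a / 2) * (a / 2 - 1)\<bar> * A / (\<delta> / 2)\<^sup>2"
  \<comment> \<open>The bounds of the interior energy inequality at height \<open>\<delta>\<close>, and the rate per unit volume.\<close>
  define L0 where "L0 = 2 * real DIM((real ^ 'n) \<times> real) * A\<^sup>2 * K\<^sup>2 + 2 * A * B * K\<^sup>2"
  have "A * B = \<bar>(a / 2) * (a / 2 - 1)\<bar> * A\<^sup>2 / (\<delta> / 2)\<^sup>2"
    by (simp add: B_def power2_eq_square)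
  then have "A * B \<ge> 0" by simp
  then have L0: "L0 \<ge> 0" unfolding L0_def by (simp add: mult.assoc[of 2 A B])
  \<comment> \<open>The volume of the box containing a half-ball of radius \<open>2 r \<le> 4\<close>.\<close>
  define N :: real where "N = 8 ^ CARD('n) * 4"
  define c where "c = min (1 / 2) (\<mu> * \<kappa> / (4 * (L0 * N + 1)))"
  have LN: "L0 * N \<ge> 0" using L0 by (simp add: N_def)
  have c: "0 < c" "c < 1" unfolding c_def using \<mu> \<kappa> LN by (auto simp: min_def)
  define m where "m = \<mu> * \<kappa> / (4 * K\<^sup>2)"
  have m: "m > 0" unfolding m_def K_def using \<mu> \<kappa> by simp
  have main: "m \<le> (LINT X:half_ball P (2 * r)|lborel. snd X powr a * (U (X, t))\<^sup>2)"
    if weak: "weak_solution a T V U" and cont: "continuous_on (half_space \<times> {0..<T}) U"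
      and bounded: "\<And>z. z \<in> half_space \<times> {0..<T} \<Longrightarrow> \<bar>U z\<bar> \<le> C0"
      and r: "0 < r" "r \<le> 2" and t: "0 \<le> t0" "t0 \<le> t" "t \<le> t0 + c" "t < T"
      and mass: "\<kappa> \<le> (LINT X:half_ball P r|lborel. snd X powr a * (U (X, t0))\<^sup>2)"
    for T V r t0 t and P :: "real ^ 'n" and U :: "((real ^ 'n) \<times> real) \<times> real \<Rightarrow> real"
  proof -
    let ?F = "\<lambda>t X. snd X powr a * (U (X, t))\<^sup>2"
    let ?W = "\<lambda>z. height z powr (a / 2) * U z"
    let ?\<phi> = "cutoff P r \<delta>"
    let ?hi = "half_ball P r \<inter> {X. h \<le> snd X}"
    let ?lo = "half_ball P r \<inter> {X. snd X < h}"
    have slice: "continuous_on half_space (\<lambda>X. U (X, \<tau>))" if "0 \<le> \<tau>" "\<tau> < T" for \<tau>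
      by (rule continuous_on_compose2[OF cont]) (use that in \<open>auto intro!: continuous_intros\<close>)
    have bd: "\<bar>U (X, \<tau>)\<bar> \<le> C0" if "X \<in> half_space" "0 \<le> \<tau>" "\<tau> < T" for X \<tau>
      using bounded that by auto
    have t0T: "t0 < T" and t0: "0 \<le> t" using t by auto
    note ws = weighted_square_integrable[OF a(1) _ slice bd]
    have intF: "set_integrable lborel (half_ball P r) (?F t0)"
      by (rule ws(1)) (use r t t0T in auto)
    have int2: "set_integrable lborel (half_ball P (2 * r)) (?F t)"
      by (rule ws(1)) (use r t t0 in auto)
    have hi_sets: "?hi \<in> sets borel" and lo_sets: "?lo \<in> sets borel"
      by (intro sets.Int borel_open open_half_ball borel_closed closed_Collect_le
          open_Collect_less continuous_intros)+
    have intlo: "set_integrable lborel ?lo (?F t0)" and inthi: "set_integrable lborel ?hi (?F t0)"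
      using hi_sets lo_sets by (auto intro!: set_integrable_subset[OF intF])
    have hi: "\<kappa> / 2 \<le> (LINT X:?hi|lborel. ?F t0 X)" and hr: "h \<le> r"
    proof -
      have low: "(LINT X:half_ball P r \<inter> {X. snd X < k}|lborel. ?F t0 X)
          \<le> \<kappa> / 2" if k: "0 \<le> k" "k \<le> h" "k \<le> r" for k
      proof -
        have "(LINT X:half_ball P r \<inter> {X. snd X < k}|lborel. ?F t0 X)
          \<le> C0\<^sup>2 * ((2 * r) ^ CARD('n) * (k powr (a + 1) / (a + 1)))"
          by (rule ws(3)) (use r t t0T k in auto)
        also have "\<dots> \<le> C0\<^sup>2 * (4 ^ CARD('n) * (h powr (a + 1) / (a + 1)))"
          using r k a by (intro mult_left_mono mult_mono power_mono divide_right_mono powr_mono2) auto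
        finally show ?thesis using thin by linarith
      qed
      \<comment> \<open>Otherwise the whole half-ball lies in the slab, whose mass is below \<open>\<kappa>\<close>.\<close>
      show hr: "h \<le> r"
      proof (rule ccontr)
        assume "\<not> h \<le> r"
        moreover have "half_ball P r \<inter> {X. snd X < r} = half_ball P r"
          using half_ball_subset_cbox by blast
        ultimately show False using low[of r] mass r \<kappa> by simp
      qed
      have "(LINT X:half_ball P r|lborel. ?F t0 X) = (LINT X:?lo \<union> ?hi|lborel. ?F t0 X)"
        by (rule arg_cong[where f = "\<lambda>S. set_lebesgue_integral lborel S _"]) auto
      also have "\<dots> = (LINT X:?lo|lborel. ?F t0 X) + (LINT X:?hi|lborel. ?F t0 X)"
        by (rule set_integral_Un[OF _ intlo inthi]) auto
      finally show "\<kappa> / 2 \<le> (LINT X:?hi|lborel. ?F t0 X)"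
        using low[of h] mass hr h by simp
    qed
    have r\<delta>: "2 * \<delta> \<le> r" using hr by (simp add: \<delta>_def)
    define x0 where "x0 = P - (2 * r) *\<^sub>R (One :: real ^ 'n)"
    define p where "p = (x0, \<delta>)"
    define q where "q = (x0 + (4 * r) *\<^sub>R (One :: real ^ 'n), 2 * r)"
    have inbox: "X \<in> cbox p q" if "X \<in> half_ball P (2 * r)" "\<delta> \<le> snd X" for X
      using half_ball_subset_cbox[OF that(1)] that(2)
      by (cases X) (auto simp: p_def q_def x0_def cbox_Pair_eq)
    have box_half: "X \<in> half_space" "\<delta> \<le> snd X" if "X \<in> cbox p q" for X
      using that \<delta> by (cases X; auto simp: p_def q_def cbox_Pair_eq half_space_def)+
    have vol: "measure lborel (cbox p q) \<le> N"
    proof -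
      have "measure lborel (cbox p q) = (4 * r) ^ CARD('n) * (2 * r - \<delta>)"
        using r r\<delta> \<delta> content_cbox_plus[of x0 "4 * r"]
        by (simp add: p_def q_def content_Pair)
      also have "\<dots> \<le> 8 ^ CARD('n) * 4"
        using r r\<delta> \<delta> by (intro mult_mono power_mono) auto
      finally show ?thesis unfolding N_def .
    qed
    have supp: "?\<phi> X = 0" if "X \<notin> cbox p q" for X
      using cutoff_eq_0(1)[OF r(1) \<delta>, of X P] inbox[of X] that by fastforce
    have \<phi>K: "\<bar>?\<phi> X\<bar> \<le> K" for X
      unfolding K_def using cutoff_bounds(1)[OF r \<delta>] nonempty_Basis by blast
    define J where "J \<tau> = integral (cbox p q) (\<lambda>X. (?W (X, \<tau>))\<^sup>2 * (?\<phi> X)\<^sup>2)" for \<tau>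
    have c\<phi>: "continuous_on S ?\<phi>" for S
      by (rule has_partial_continuous(1)[OF has_partial_cutoff])
    have energy: "J t \<ge> J \<tau> - L0 * measure lborel (cbox p q) * (t - \<tau>)" if \<tau>: "0 < \<tau>" "\<tau> \<le> t" for \<tau>
      unfolding J_def L0_def
    proof (rule interior_energy_inequality[OF weak a(2) _ _ \<delta>(1) _ has_partial_cutoff supp \<phi>K _ \<tau> t(4) A_def B_def])
      show "continuous_on (half_space \<times> {0<..<T}) U"
        by (rule continuous_on_subset[OF cont]) auto
      show "\<bar>U z\<bar> \<le> C0" if "z \<in> half_space \<times> {0<..<T}" for z
        using bounded that by auto
      show "\<delta> \<le> snd p" by (simp add: p_def)
      show "\<bar>cutoff_partial P r \<delta> i X\<bar> \<le> K" if "i \<in> Basis" for X i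
        unfolding K_def by (rule cutoff_bounds(2)[OF r \<delta> that])
    qed
    \<comment> \<open>The interior inequality starts at positive times; \<open>t0 = 0\<close> is reached by continuity of \<open>J\<close>.\<close>
    have Jt: "J t0 - \<mu> * \<kappa> / 4 \<le> J t"
    proof -
      have lip: "J \<tau> \<le> J t + \<mu> * \<kappa> / 4" if \<tau>: "t0 \<le> \<tau>" "0 < \<tau>" "\<tau> \<le> t" for \<tau>
      proof -
        have "L0 * measure lborel (cbox p q) * (t - \<tau>) \<le> (L0 * N) * c"
          using \<tau> t vol L0 by (intro mult_mono mult_left_mono) (auto simp: N_def)
        also have "\<dots> \<le> (L0 * N + 1) * (\<mu> * \<kappa> / (4 * (L0 * N + 1)))"
          using LN c(1) by (intro mult_mono) (auto simp: c_def)
        also have "\<dots> = \<mu> * \<kappa> / 4"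
        proof -
          have "x * (y / (4 * x)) = y / 4" if "x > 0" for x y :: real
            using that by simp
          then show ?thesis using LN by (simp only:)
        qed
        finally show ?thesis using energy[OF \<tau>(2,3)] by linarith
      qed
      show ?thesis
      proof (cases "t0 < t")
        case True
        have "continuous_on {t0..t} J"
          unfolding J_def[abs_def]
        proof (rule integral_continuous_on_param)
          have "continuous_on ({t0..t} \<times> cbox p q) (\<lambda>x. U (snd x, fst x))"
            by (rule continuous_on_compose2[OF cont])
               (use t box_half in \<open>auto intro!: continuous_intros\<close>)
          moreover have "continuous_on ({t0..t} \<times> cbox p q) (\<lambda>x. cutoff P r \<delta> (snd x))"
            by (rule continuous_on_compose2[OF c\<phi>[of UNIV]]) (auto intro!: continuous_intros)
          moreover have "continuous_on ({t0..t} \<times> cbox p q) (\<lambda>x. snd (snd x) powr (a / 2))"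
            using box_half(2) \<delta> by (intro continuous_intros) fastforce
          ultimately show "continuous_on ({t0..t} \<times> cbox p q) (\<lambda>(\<tau>, X). (?W (X, \<tau>))\<^sup>2 * (?\<phi> X)\<^sup>2)"
            unfolding case_prod_unfold fst_conv snd_conv by (intro continuous_on_mult continuous_on_power)
        qed
        then have "J t0 \<le> J t + \<mu> * \<kappa> / 4"
          using True t(1) lip
          by (intro continuous_le_on_closure[of "{t0<..t}" J t0]) auto
        then show ?thesis by simp
      next
        case False
        then have "t0 = t" using t by simp
        then show ?thesis using \<mu> \<kappa> by simp
      qed
    qed
    have setint: "set_integrable lborel (cbox p q) (\<lambda>X. (?W (X, \<tau>))\<^sup>2 * (?\<phi> X)\<^sup>2)"
      if "0 \<le> \<tau>" "\<tau> < T" for \<tau>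
      unfolding set_integrable_def
    proof (intro borel_integrable_compact compact_cbox continuous_intros c\<phi>)
      show "continuous_on (cbox p q) (\<lambda>X. U (X, \<tau>))"
        by (rule continuous_on_subset[OF slice[OF that]]) (use box_half in blast)
    qed (use box_half \<delta> in fastforce)
    have J_eq: "J \<tau> = (LINT X:cbox p q|lborel. (?W (X, \<tau>))\<^sup>2 * (?\<phi> X)\<^sup>2)"
      if "0 \<le> \<tau>" "\<tau> < T" for \<tau>
      unfolding J_def by (rule set_borel_integral_eq_integral(2)[OF setint[OF that], symmetric])
    have W2: "(?W (X, \<tau>))\<^sup>2 = ?F \<tau> X" if "X \<in> half_space" for X \<tau>
      by (simp add: power_mult_distrib power2_eq_square[of "snd X powr _"] flip: powr_add)
    have "\<mu> * (\<kappa> / 2) \<le> \<mu> * (LINT X:?hi|lborel. ?F t0 X)" using hi \<mu> by simp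
    also have "\<dots> = (LINT X:?hi|lborel. \<mu> * ?F t0 X)" by simp
    also have "\<dots> \<le> J t0"
      unfolding J_eq[OF t(1) t0T] set_lebesgue_integral_def
    proof (rule integral_mono)
      show "integrable lborel (\<lambda>X. indicator ?hi X *\<^sub>R (\<mu> * ?F t0 X))"
        using set_integrable_mult_right[OF inthi, of \<mu>] unfolding set_integrable_def by simp
      show "integrable lborel (\<lambda>X. indicator (cbox p q) X *\<^sub>R ((?W (X, t0))\<^sup>2 * (?\<phi> X)\<^sup>2))"
        using setint[OF t(1) t0T] unfolding set_integrable_def .
      fix X
      show "indicator ?hi X *\<^sub>R (\<mu> * ?F t0 X)
          \<le> indicator (cbox p q) X *\<^sub>R ((?W (X, t0))\<^sup>2 * (?\<phi> X)\<^sup>2)"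
      proof (cases "X \<in> ?hi")
        case True
        then have X: "X \<in> half_ball P r" "2 * \<delta> \<le> snd X" by (auto simp: \<delta>_def)
        then have "X \<in> half_ball P (2 * r)" using r by (auto simp: half_ball_def)
        then have "X \<in> cbox p q" using inbox X \<delta> by auto
        moreover have "\<mu> \<le> (?\<phi> X)\<^sup>2"
          unfolding \<mu>_def by (rule cutoff_lower_bound[OF \<delta> r\<delta> X])
        moreover have "X \<in> half_space" using X(1) by (auto simp: half_ball_def half_space_def)
        ultimately show ?thesis using True
          by (simp only: W2 indicator_simps scaleR_one) (simp add: mult.commute mult_right_mono)
      qed simp
    qed
    finally have "\<mu> * \<kappa> / 4 \<le> J t" using Jt by simp
    also have "J t \<le> (LINT X:half_ball P (2 * r)|lborel. K\<^sup>2 * ?F t X)"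
      unfolding J_eq[OF t0 t(4)] set_lebesgue_integral_def
    proof (rule integral_mono)
      show "integrable lborel (\<lambda>X. indicator (half_ball P (2 * r)) X *\<^sub>R (K\<^sup>2 * ?F t X))"
        using set_integrable_mult_right[OF int2, of "K\<^sup>2"] unfolding set_integrable_def by simp
      show "integrable lborel (\<lambda>X. indicator (cbox p q) X *\<^sub>R ((?W (X, t))\<^sup>2 * (?\<phi> X)\<^sup>2))"
        using setint[OF t0 t(4)] unfolding set_integrable_def .
      fix X
      show "indicator (cbox p q) X *\<^sub>R ((?W (X, t))\<^sup>2 * (?\<phi> X)\<^sup>2)
          \<le> indicator (half_ball P (2 * r)) X *\<^sub>R (K\<^sup>2 * ?F t X)"
      proof (cases "X \<in> half_ball P (2 * r)")
        case True
        then have "X \<in> half_space" by (auto simp: half_ball_def half_space_def)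
        have "\<bar>?\<phi> X\<bar>\<^sup>2 \<le> K\<^sup>2" by (intro power_mono \<phi>K) simp
        then have "?F t X * (?\<phi> X)\<^sup>2 \<le> ?F t X * K\<^sup>2" by (intro mult_left_mono) auto
        moreover have "indicator (cbox p q) X *\<^sub>R (?F t X * (?\<phi> X)\<^sup>2) \<le> ?F t X * (?\<phi> X)\<^sup>2"
          by (auto simp: indicator_def)
        ultimately show ?thesis using True
          unfolding W2[OF \<open>X \<in> half_space\<close>] by (simp add: mult.commute)
      next
        case False
        then show ?thesis using cutoff_eq_0(1)[OF r(1) \<delta>, of X P] by simp
      qed
    qed
    also have "\<dots> = K\<^sup>2 * (LINT X:half_ball P (2 * r)|lborel. ?F t X)" by simp
    finally show ?thesis unfolding m_def by (simp add: K_def field_simps)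
  qed
  show ?thesis by (rule that[OF m c main])
qed

text \<open>
  Change of variables \<open>Z = (x0, 0) + R X\<close>: the volume element contributes \<open>R\<^bsup>n+1\<^esup>\<close> and the weight \<open>R\<^sup>a\<close>.
\<close>

lemma rescaled_weighted_integral:
  fixes U :: "((real ^ 'n) \<times> real) \<times> real \<Rightarrow> real"
  assumes R: "R > 0"
    and meas: "(\<lambda>X. indicator (half_ball x0 (R * \<rho>)) X * (snd X powr a * (U (X, R\<^sup>2 * t + t0))\<^sup>2)) \<in> borel_measurable borel"
  shows "R powr (real CARD('n) + a + 1) *
      (LINT X:half_ball 0 \<rho>|lborel. (rescaled U x0 R t0 (X, t))\<^sup>2 * snd X powr a)
    = (LINT X:half_ball x0 (R * \<rho>)|lborel. snd X powr a * (U (X, R\<^sup>2 * t + t0))\<^sup>2)"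
proof -
  let ?F = "\<lambda>X. snd X powr a * (U (X, R\<^sup>2 * t + t0))\<^sup>2"
  let ?G = "\<lambda>X. (rescaled U x0 R t0 (X, t))\<^sup>2 * snd X powr a"
  let ?A = "\<lambda>X. (x0, 0) + R *\<^sub>R X"
  have mem: "?A X \<in> half_ball x0 (R * \<rho>) \<longleftrightarrow> X \<in> half_ball 0 \<rho>" for X :: "(real ^ 'n) \<times> real"
  proof -
    have "dist (?A X) (x0, 0) = R * dist X (0, 0)"
      using R by (simp add: dist_norm zero_prod_def[symmetric])
    then show ?thesis using R by (simp add: half_ball_def zero_less_mult_iff)
  qed
  have "indicator (half_ball x0 (R * \<rho>)) (?A X) * ?F (?A X) = R powr a * (indicator (half_ball 0 \<rho>) X * ?G X)"
    for X :: "(real ^ 'n) \<times> real"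
  proof (cases "X \<in> half_ball 0 \<rho>")
    case True
    then have "snd X > 0" by (simp add: half_ball_def)
    then show ?thesis using True mem[of X] R
      by (simp add: rescaled_def powr_mult add.commute mult_ac)
  next
    case False
    then show ?thesis using mem[of X] by simp
  qed
  then have "(LINT X:half_ball x0 (R * \<rho>)|lborel. ?F X)
      = R ^ DIM((real ^ 'n) \<times> real) * (LINT X|lborel. R powr a * (indicator (half_ball 0 \<rho>) X * ?G X))"
    using lborel_integral_affine[OF meas, of R "(x0, 0)"] R by (simp add: set_lebesgue_integral_def)
  also have "R ^ DIM((real ^ 'n) \<times> real) = R powr (real CARD('n) + 1)"
    using R by (simp add: powr_add powr_realpow)
  finally show ?thesis
    using R by (simp add: set_lebesgue_integral_def powr_add mult_ac)
qed

theorem lemma3p5: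
  fixes s a \<kappa> C0 :: real
  assumes "1/2 \<le> s" and "s < 1" and "a = 1 - 2 * s" and "0 < \<kappa>" and "\<kappa> < 1"
  shows "\<exists>M>0. \<exists>c>0. c < 1 \<and>
    (\<forall>(T::real) (V :: (real ^ 'n) \<times> real \<Rightarrow> real)
       (U :: ((real ^ 'n) \<times> real) \<times> real \<Rightarrow> real)
       (x0 :: real ^ 'n) (\<rho>::real) (R::real) (t0::real).
       standing_setting s C0 T V U \<longrightarrow>
       0 < \<rho> \<longrightarrow> \<rho> < 1 \<longrightarrow> R \<ge> 10 \<longrightarrow> R * \<rho> = 2 * norm x0 \<longrightarrow>
       0 \<le> t0 \<longrightarrow> t0 < 1/4 \<longrightarrow>
       (LINT X:half_ball 0 1|lborel. (snd X) powr a * (U (X, t0))\<^sup>2) \<ge> \<kappa> \<longrightarrow>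
       R powr (real CARD('n) + a + 1) *
         (LINT X:half_ball 0 \<rho>|lborel. (rescaled U x0 R t0 (X, 0))\<^sup>2 * (snd X) powr a) \<ge> \<kappa> \<longrightarrow>
       (\<forall>t. 0 \<le> t \<and> t \<le> c / R\<^sup>2 \<longrightarrow>
          M * (LINT X:half_ball 0 (2 * \<rho>)|lborel. (rescaled U x0 R t0 (X, t))\<^sup>2 * (snd X) powr a)
            \<ge> R powr (- (real CARD('n) + a + 1))))"
proof -
  have a: "-1 < a" "a \<le> 0" using assms by auto
  obtain m c :: real where m: "0 < m" and c: "0 < c" "c < 1" and persist:
    "\<And>T V (U :: ((real ^ 'n) \<times> real) \<times> real \<Rightarrow> real) P r t0 t.
       weak_solution a T V U \<Longrightarrow> continuous_on (half_space \<times> {0..<T}) U \<Longrightarrow>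
       (\<And>z. z \<in> half_space \<times> {0..<T} \<Longrightarrow> \<bar>U z\<bar> \<le> C0) \<Longrightarrow>
       0 < r \<Longrightarrow> r \<le> 2 \<Longrightarrow> 0 \<le> t0 \<Longrightarrow> t0 \<le> t \<Longrightarrow> t \<le> t0 + c \<Longrightarrow> t < T \<Longrightarrow>
       \<kappa> \<le> (LINT X:half_ball P r|lborel. snd X powr a * (U (X, t0))\<^sup>2) \<Longrightarrow>
       m \<le> (LINT X:half_ball P (2 * r)|lborel. snd X powr a * (U (X, t))\<^sup>2)"
    by (fact local_mass_persistence[OF a assms(4), of C0])
  have "R powr (- (real CARD('n) + a + 1)) \<le> 1 / m *
      (LINT X:half_ball 0 (2 * \<rho>)|lborel. (rescaled U x0 R t0 (X, t))\<^sup>2 * (snd X) powr a)"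
    if setting: "standing_setting s C0 T V U" and \<rho>: "0 < \<rho>" "\<rho> < 1" and R: "R \<ge> 10"
      and x0: "R * \<rho> = 2 * norm x0" and t0: "0 \<le> t0" "t0 < 1/4"
      and unit: "(LINT X:half_ball 0 1|lborel. (snd X) powr a * (U (X, t0))\<^sup>2) \<ge> \<kappa>"
      and ball: "R powr (real CARD('n) + a + 1) *
         (LINT X:half_ball 0 \<rho>|lborel. (rescaled U x0 R t0 (X, 0))\<^sup>2 * (snd X) powr a) \<ge> \<kappa>"
      and t: "0 \<le> t" "t \<le> c / R\<^sup>2"
    for T V x0 \<rho> R t0 t and U :: "((real ^ 'n) \<times> real) \<times> real \<Rightarrow> real"
  proof -
    define t' where "t' = R\<^sup>2 * t + t0"
    have T: "T > 4" and weak: "weak_solution a T V U"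
      and cont: "continuous_on (closed_half_space \<times> {0..<T}) U"
      and bounded: "\<And>z. z \<in> closed_half_space \<times> {0..<T} \<Longrightarrow> \<bar>U z\<bar> \<le> C0"
      using setting assms(3) unfolding standing_setting_def by auto
    have sub: "half_space \<subseteq> closed_half_space" by (auto simp: half_space_def closed_half_space_def)
    have cont': "continuous_on (half_space \<times> {0..<T}) U"
      by (rule continuous_on_subset[OF cont]) (use sub in auto)
    have bounded': "\<bar>U z\<bar> \<le> C0" if "z \<in> half_space \<times> {0..<T}" for z
      by (rule bounded) (use that sub in auto)
    have "R\<^sup>2 * t \<le> R\<^sup>2 * (c / R\<^sup>2)" using t by (intro mult_left_mono) auto
    then have t': "t0 \<le> t'" "t' \<le> t0 + c" "t' < T" "0 \<le> t'"
      using R t t0 c T by (auto simp: t'_def)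
    have ws: "set_integrable lborel (half_ball P r) (\<lambda>X. snd X powr a * (U (X, \<tau>))\<^sup>2)"
      "(\<lambda>X. indicator (half_ball P r) X * (snd X powr a * (U (X, \<tau>))\<^sup>2)) \<in> borel_measurable borel"
      if "r > 0" "0 \<le> \<tau>" "\<tau> < T" for P r \<tau>
    proof -
      have s: "continuous_on half_space (\<lambda>X. U (X, \<tau>))"
        by (rule continuous_on_compose2[OF cont']) (use that in \<open>auto intro!: continuous_intros\<close>)
      have b: "\<bar>U (X, \<tau>)\<bar> \<le> C0" if "X \<in> half_space" for X
        using bounded' that \<open>0 \<le> \<tau>\<close> \<open>\<tau> < T\<close> by auto
      show "set_integrable lborel (half_ball P r) (\<lambda>X. snd X powr a * (U (X, \<tau>))\<^sup>2)"
        "(\<lambda>X. indicator (half_ball P r) X * (snd X powr a * (U (X, \<tau>))\<^sup>2)) \<in> borel_measurable borel"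
        by (rule weighted_square_integrable[OF a(1) that(1) s b]; assumption)+
    qed
    define r where "r = R * \<rho>"
    have r: "r > 0" "r = 2 * norm x0" using R \<rho> x0 by (auto simp: r_def)
    have mass: "m \<le> (LINT X:half_ball x0 (2 * r)|lborel. snd X powr a * (U (X, t'))\<^sup>2)"
    \<comment> \<open>For \<open>\<bar>x0\<bar> \<le> 1\<close> the radius is at most \<open>2\<close>. Otherwise the mass comes from the half-balls about \<open>0\<close>:
      a point at distance less than \<open>2\<close> from \<open>0\<close> has distance less than \<open>2 + \<bar>x0\<bar> < 2 r\<close> from \<open>x0\<close>.\<close>
    proof (cases "norm x0 \<le> 1")
      case True
      have "R powr (real CARD('n) + a + 1) *
         (LINT X:half_ball 0 \<rho>|lborel. (rescaled U x0 R t0 (X, 0))\<^sup>2 * (snd X) powr a)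
        = (LINT X:half_ball x0 r|lborel. snd X powr a * (U (X, R\<^sup>2 * 0 + t0))\<^sup>2)"
        unfolding r_def
        by (rule rescaled_weighted_integral) (use R \<rho> ws(2)[of r t0 x0] t0 T in \<open>simp_all add: r_def\<close>)
      then have "\<kappa> \<le> (LINT X:half_ball x0 r|lborel. snd X powr a * (U (X, t0))\<^sup>2)"
        using ball by simp
      then show ?thesis
        using True r by (intro persist[OF weak cont' bounded' _ _ t0(1) t'(1-3)]) auto
    next
      case False
      have "m \<le> (LINT X:half_ball 0 (2 * 1)|lborel. snd X powr a * (U (X, t'))\<^sup>2)"
        by (rule persist[OF weak cont' bounded' _ _ t0(1) t'(1-3) unit]) auto
      also have "\<dots> \<le> (LINT X:half_ball x0 (2 * r)|lborel. snd X powr a * (U (X, t'))\<^sup>2)"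
        unfolding set_lebesgue_integral_def
      proof (rule integral_mono)
        fix X :: "(real ^ 'n) \<times> real"
        have "dist X (x0, 0) \<le> dist X (0, 0) + norm x0"
          using dist_triangle[of X "(x0, 0)" "(0, 0)"] by (simp add: dist_norm norm_Pair)
        show "indicator (half_ball 0 (2 * 1)) X *\<^sub>R (snd X powr a * (U (X, t'))\<^sup>2)
            \<le> indicator (half_ball x0 (2 * r)) X *\<^sub>R (snd X powr a * (U (X, t'))\<^sup>2)"
          using \<open>dist X (x0, 0) \<le> _\<close> False r by (auto simp: half_ball_def indicator_def)
      qed (use ws(1)[of _ t'] r t' in \<open>auto simp: set_integrable_def\<close>)
      finally show ?thesis .
    qed
    let ?I = "LINT X:half_ball 0 (2 * \<rho>)|lborel. (rescaled U x0 R t0 (X, t))\<^sup>2 * (snd X) powr a"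
    have "R powr (real CARD('n) + a + 1) * ?I
        = (LINT X:half_ball x0 (R * (2 * \<rho>))|lborel. snd X powr a * (U (X, R\<^sup>2 * t + t0))\<^sup>2)"
      by (rule rescaled_weighted_integral) (use R \<rho> ws(2)[of "R * (2 * \<rho>)" t' x0] t' in \<open>simp_all add: t'_def\<close>)
    then have "m \<le> R powr (real CARD('n) + a + 1) * ?I"
      using mass by (simp add: r_def t'_def mult_ac)
    then have "R powr (- (real CARD('n) + a + 1)) * m
        \<le> R powr (- (real CARD('n) + a + 1)) * (R powr (real CARD('n) + a + 1) * ?I)"
      by (intro mult_left_mono) auto
    also have "\<dots> = ?I"
    proof -
      have "R powr (- x) * (R powr x * y) = y" for x y :: real
        using R by (simp add: powr_minus)
      then show ?thesis .
    qed
    finally show ?thesis using m by (simp add: field_simps)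
  qed
  then show ?thesis using m c by (intro exI[of _ "1 / m"] exI[of _ c] conjI allI impI) auto
qed

end
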